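(* Let $a>0$ and let $p\ge 0$ be an integer. Let $f\in C(\mathbb{R})$ satisfy $|f(\nu)|\le K e^{N|\nu|}$ for all $\nu\in\mathbb{R}$, for some constants $K\ge 0$ and $N\ge 0$, and suppose that $f^{(p+2)}$ exists at a fixed point $x\in\mathbb{R}$. Then $$\lim_{\lambda\to\infty}\lambda\left[(T_{\lambda,a}^{(p)}f)(x)-f^{(p)}(x)\right]=\frac{p(p-1)}{2}f^{(p)}(x)+p\,x\,f^{(p+1)}(x)+\frac{a^2+x^2}{2}f^{(p+2)}(x).$$
   Context: For $a>0$, $\lambda>0$ and $x\in\mathbb{R}$, the operator $T_{\lambda,a}$ is defined, for functions $f$ for which the integral exists, by $$(T_{\lambda,a}f)(x)=\int_{-\infty}^{\infty}\kappa_\lambda^a(x,\nu)f(\nu)\,d\nu,\qquad \kappa_\lambda^a(x,\nu)=\frac{2^{\lambda-2}\lambda}{\pi\Gamma(\lambda)}\,\frac{a^{\lambda-1}}{(a^2+x^2)^{\lambda/2}}\left|\Gamma\!\left(\frac{\lambda a+i\lambda\nu}{2a}\right)\right|^2 e^{\frac{\lambda\nu}{a}\arctan\frac{x}{a}}.$$ $(T_{\lambda,a}^{(p)}f)(x)$ denotes $\left(\frac{\partial^p}{\partial w^p}(T_{\lambda,a}f)(w)\right)_{w=x}$, the $p$-th derivative of the function $T_{\lambda,a}f$ at $x$. For $f$ of exponential growth, $(T_{\lambda,a}f)$ is considered near a given point for all sufficiently large $\lambda$, for which the integral converges. *)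

theory Defs
  imports "HOL-Analysis.Analysis"
begin

definition kappa :: "real \<Rightarrow> real \<Rightarrow> real \<Rightarrow> real \<Rightarrow> real" where
  "kappa l a x \<nu> =
     (2 powr (l - 2) * l) / (pi * Gamma l)
     * (a powr (l - 1) / (a\<^sup>2 + x\<^sup>2) powr (l / 2))
     * (cmod (Gamma ((complex_of_real (l * a) + \<i> * complex_of_real (l * \<nu>))
                     / complex_of_real (2 * a))))\<^sup>2
     * exp (l * \<nu> / a * arctan (x / a))"

text \<open>The integral is the Lebesgue integral over the real line. It has the junk value 0 where the
  integrand is not integrable, so convergence has to be stated separately.\<close>

definition T_integrable :: "real \<Rightarrow> real \<Rightarrow> (real \<Rightarrow> real) \<Rightarrow> real \<Rightarrow> bool" where
  "T_integrable l a f x \<longleftrightarrow> integrable lborel (\<lambda>\<nu>. kappa l a x \<nu> * f \<nu>)"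

definition T_op :: "real \<Rightarrow> real \<Rightarrow> (real \<Rightarrow> real) \<Rightarrow> real \<Rightarrow> real" where
  "T_op l a f x = (LINT \<nu>|lborel. kappa l a x \<nu> * f \<nu>)"

text \<open>The \<open>n\<close>-th derivative is \<open>(deriv ^^ n) f\<close>, which is a total function. The following predicate
  says that it genuinely exists at \<open>x\<close>: the derivative of order \<open>n - 1\<close> exists in a neighbourhood
  of \<open>x\<close> and is differentiable at \<open>x\<close>.\<close>

primrec nth_deriv_exists :: "nat \<Rightarrow> (real \<Rightarrow> real) \<Rightarrow> real \<Rightarrow> bool" where
  "nth_deriv_exists 0 f x \<longleftrightarrow> True"
| "nth_deriv_exists (Suc n) f x \<longleftrightarrow>
     (\<forall>\<^sub>F y in nhds x. nth_deriv_exists n f y) \<and> ((deriv ^^ n) f) differentiable (at x)"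

end

theory Submission
  imports Defs "HOL-Probability.Probability" "HOL-Complex_Analysis.Complex_Analysis"
begin

text \<open>
  Write \<open>\<theta> = arctan (y / a)\<close>. The Fourier transform of \<open>v \<mapsto> exp (\<alpha> v - exp (v + \<i> \<theta>))\<close> is, up to a
  phase, \<open>t \<mapsto> exp (\<theta> t) \<Gamma>(\<alpha> + \<i> t)\<close> (the Gamma integral along a rotated ray), so Plancherel's formula
  evaluates \<open>\<integral> |\<Gamma>(\<alpha> + \<i> t)|\<^sup>2 exp (2 \<theta> t) dt\<close> and shows that the kernel is a probability density for
  every real \<open>y\<close>. Comparing the kernels at \<open>x\<close> and at \<open>x \<plusminus> c / \<surd>\<lambda>\<close> bounds all exponential moments of
  \<open>\<surd>\<lambda> |\<nu> - x|\<close> uniformly for large \<open>\<lambda>\<close>.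

  Split \<open>f\<close> into its Taylor polynomial of degree \<open>p + 2\<close> at \<open>x\<close> and a remainder \<open>R\<close>. Since
  \<open>(a\<^sup>2 + y\<^sup>2) \<partial>\<kappa>/\<partial>y = \<lambda> (\<nu> - y) \<kappa>\<close>, the operator maps \<open>(\<nu> - x)\<^sup>j\<close> to an explicit polynomial in \<open>y - x\<close> and
  \<open>1/\<lambda>\<close>, which yields the limit. The function \<open>T R\<close> extends holomorphically to \<open>|w - x| < 2 / \<surd>\<lambda>\<close> and is
  \<open>o(\<lambda>^(-(p+2)/2))\<close> there, so Cauchy's estimate on the circle of radius \<open>1 / \<surd>\<lambda>\<close> makes its \<open>p\<close>-th
  derivative at \<open>x\<close> of size \<open>o(1/\<lambda>)\<close>, without differentiating the kernel \<open>p\<close> times.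
\<close>

subsection \<open>Integrals depending on a parameter and the rotated Gamma integral\<close>

lemma has_field_derivative_lebesgue_integral:
  fixes f :: "'a::{real_normed_field,banach,second_countable_topology} \<Rightarrow> 'b \<Rightarrow> 'a"
  assumes S: "open S" "convex S" "w \<in> S"
    and int: "\<And>z. z \<in> S \<Longrightarrow> integrable M (f z)"
    and der: "\<And>z t. z \<in> S \<Longrightarrow> ((\<lambda>z. f z t) has_field_derivative f' z t) (at z)"
    and bound: "\<And>z t. z \<in> S \<Longrightarrow> norm (f' z t) \<le> g t"
    and g: "integrable M g"
  shows "((\<lambda>z. \<integral>t. f z t \<partial>M) has_field_derivative (\<integral>t. f' w t \<partial>M)) (at w)"
proof -
  define q where "q z t = (f z t - f w t) / (z - w)" for z t
  have q_meas: "q z \<in> borel_measurable M" if "z \<in> S" for z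
    unfolding q_def using int[OF that] int[OF S(3)] by measurable
  have q_bound: "norm (q z t) \<le> g t" if "z \<in> S - {w}" for z t
  proof -
    have "norm (f z t - f w t) \<le> g t * norm (z - w)"
      by (rule field_differentiable_bound[OF S(2), where f' = "\<lambda>z. f' z t"])
        (use der bound S that in \<open>auto intro: has_field_derivative_at_within\<close>)
    thus ?thesis using that by (simp add: q_def norm_divide divide_le_eq)
  qed
  have q_lim: "(\<lambda>n. q (X n) t) \<longlonglongrightarrow> f' w t" if "\<forall>i. X i \<in> S - {w}" "X \<longlonglongrightarrow> w" for X t
  proof -
    have "((\<lambda>z. q z t) \<longlongrightarrow> f' w t) (at w within S)"
      using der[OF S(3), of t] by (auto simp: q_def has_field_derivative_iff at_within_open[OF S(3,1)])
    from this[unfolded tendsto_at_iff_sequentially] that show ?thesis by (auto simp: o_def)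
  qed
  have f'_meas: "f' w \<in> borel_measurable M"
  proof -
    have "w islimpt S" using S by (simp add: interior_limit_point interior_open)
    then obtain X where X: "\<forall>i. X i \<in> S - {w}" "X \<longlonglongrightarrow> w"
      by (auto simp: islimpt_sequential)
    show ?thesis
    proof (rule borel_measurable_LIMSEQ_metric)
      show "q (X n) \<in> borel_measurable M" for n using X q_meas by blast
      show "(\<lambda>n. q (X n) t) \<longlonglongrightarrow> f' w t" for t using X q_lim by blast
    qed
  qed
  have "((\<lambda>z. \<integral>t. q z t \<partial>M) \<longlongrightarrow> (\<integral>t. f' w t \<partial>M)) (at w within S)"
    unfolding tendsto_at_iff_sequentially
  proof (intro allI impI)
    fix X assume X: "\<forall>i. X i \<in> S - {w}" "X \<longlonglongrightarrow> w"
    show "((\<lambda>z. \<integral>t. q z t \<partial>M) \<circ> X) \<longlonglongrightarrow> (\<integral>t. f' w t \<partial>M)"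
      unfolding o_def
      by (rule integral_dominated_convergence[OF f'_meas _ g])
        (use X q_meas q_bound q_lim[OF X] in \<open>simp_all add: o_def\<close>)
  qed
  moreover have "\<forall>\<^sub>F z in at w within S. (\<integral>t. q z t \<partial>M) = ((\<integral>t. f z t \<partial>M) - (\<integral>t. f w t \<partial>M)) / (z - w)"
    using int[OF S(3)] int by (auto simp: eventually_at_filter q_def)
  ultimately show ?thesis
    unfolding has_field_derivative_iff at_within_open[OF S(3,1)] by (blast intro: Lim_transform_eventually)
qed

lemma holomorphic_on_lebesgue_integral:
  fixes f :: "complex \<Rightarrow> 'b \<Rightarrow> complex"
  assumes S: "open S"
    and meas: "\<And>z. z \<in> S \<Longrightarrow> f z \<in> borel_measurable M"
    and hol: "\<And>t. (\<lambda>z. f z t) holomorphic_on S"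
    and dom: "\<And>w. w \<in> S \<Longrightarrow> \<exists>r>0. \<exists>g. integrable M g \<and> (\<forall>z\<in>cball w r \<inter> S. \<forall>t. norm (f z t) \<le> g t)"
  shows "(\<lambda>z. \<integral>t. f z t \<partial>M) holomorphic_on S"
  unfolding holomorphic_on_open[OF S]
proof (rule ballI, rule exI)
  fix w assume w: "w \<in> S"
  obtain r1 g where r1: "r1 > 0" "integrable M g" "\<And>z t. z \<in> cball w r1 \<inter> S \<Longrightarrow> norm (f z t) \<le> g t"
    using dom[OF w] by blast
  obtain r2 where r2: "r2 > 0" "cball w r2 \<subseteq> S" using S w open_contains_cball by blast
  define r where "r = min r1 r2"
  have r: "r > 0" "cball w r \<subseteq> S" "\<And>z t. z \<in> cball w r \<Longrightarrow> norm (f z t) \<le> g t"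
    using r1 r2 by (auto simp: r_def subset_iff)
  have in_cball: "cball z (r/2) \<subseteq> cball w r" if "z \<in> ball w (r/2)" for z
  proof
    fix u assume "u \<in> cball z (r/2)"
    thus "u \<in> cball w r" using that dist_triangle[of w u z] by auto
  qed
  have sub: "ball w (r/2) \<subseteq> S" using r by (auto simp: subset_iff)
  show "((\<lambda>z. \<integral>t. f z t \<partial>M) has_field_derivative (\<integral>t. deriv (\<lambda>z. f z t) w \<partial>M)) (at w)"
  proof (rule has_field_derivative_lebesgue_integral[where S = "ball w (r/2)" and g = "\<lambda>t. g t / (r/2)"])
    fix z assume "z \<in> ball w (r/2)"
    thus "integrable M (f z)"
      using sub r by (intro Bochner_Integration.integrable_bound[OF r1(2)] meas AE_I2)
        (auto intro: order_trans[OF _ abs_ge_self])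
  next
    fix z t assume z: "z \<in> ball w (r/2)"
    show "((\<lambda>z. f z t) has_field_derivative deriv (\<lambda>z. f z t) z) (at z)"
      using holomorphic_derivI[OF hol S] sub z by blast
    have "norm ((deriv ^^ 1) (\<lambda>z. f z t) z) \<le> fact 1 * g t / (r/2) ^ 1"
      by (rule Cauchy_inequality)
        (use in_cball[OF z] r hol[of t] in \<open>auto intro!: holomorphic_on_imp_continuous_on
           elim: holomorphic_on_subset simp: subset_iff dist_norm\<close>)
    thus "norm (deriv (\<lambda>z. f z t) z) \<le> g t / (r/2)" by simp
  qed (use r r1 in auto)
qed

lemma Gamma_integral_exp:
  assumes z: "Re z > 0"
  shows "has_bochner_integral lborel (\<lambda>v. exp (z * of_real v - of_real (exp v))) (Gamma z)"
proof -
  let ?f = "\<lambda>t. complex_of_real t powr (z - 1) / of_real (exp t)"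
  let ?h = "\<lambda>v. exp (z * complex_of_real v - of_real (exp v))"
  have range: "exp ` (UNIV::real set) = {0<..}"
    by (auto simp: image_iff) (metis exp_ln)
  have eq: "\<bar>exp v\<bar> *\<^sub>R ?f (exp v) = ?h v" for v
    by (simp add: powr_def Ln_of_real scaleR_conv_of_real exp_diff algebra_simps flip: exp_of_real)
  have "?f absolutely_integrable_on {0<..} \<and> integral {0<..} ?f = Gamma z"
    using absolutely_integrable_Gamma_integral'[OF z] Gamma_integral_complex'[OF z] by blast
  moreover have "(\<lambda>v. \<bar>exp v\<bar> *\<^sub>R ?f (exp v)) absolutely_integrable_on UNIV \<and>
      integral UNIV (\<lambda>v. \<bar>exp v\<bar> *\<^sub>R ?f (exp v)) = Gamma z
    \<longleftrightarrow> ?f absolutely_integrable_on exp ` (UNIV::real set) \<and> integral (exp ` UNIV) ?f = Gamma z"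
    by (rule has_absolute_integral_change_of_variables_real) (auto simp: inj_on_def)
  ultimately have "?h absolutely_integrable_on UNIV \<and> integral UNIV ?h = Gamma z"
    unfolding eq range by blast
  hence 1: "integrable lebesgue ?h" "integral UNIV ?h = Gamma z" by (auto simp: set_integrable_def)
  have m: "?h \<in> borel_measurable lborel"
    by measurable
  have 2: "integrable lborel ?h"
    using 1 integrable_completion[OF m] by simp
  have "integral\<^sup>L lborel ?h = integral UNIV ?h"
    using integral_lborel[OF 2] by simp
  thus ?thesis using 1 2 by (simp add: has_bochner_integral_iff)
qed

lemma norm_exp_Gamma_kernel:
  "norm (exp (z * of_real v - exp (of_real v + s))) = exp (Re z * v - exp (v + Re s) * cos (Im s))"
  by (simp add: norm_exp_eq_Re Re_exp)

lemma has_bochner_integral_Gamma_real_shift: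
  assumes z: "Re z > 0"
  shows "has_bochner_integral lborel (\<lambda>v. exp (z * of_real v - exp (of_real v + of_real \<sigma>)))
           (exp (- (z * of_real \<sigma>)) * Gamma z)"
proof -
  have "has_bochner_integral lborel
      (\<lambda>v. exp (z * of_real (\<sigma> + 1 * v) - of_real (exp (\<sigma> + 1 * v)))) (Gamma z /\<^sub>R \<bar>1\<bar>)"
    using Gamma_integral_exp[OF z] by (subst (asm) lborel_has_bochner_integral_real_affine_iff[of 1 _ _ \<sigma>]) auto
  hence "has_bochner_integral lborel
      (\<lambda>v. exp (- (z * of_real \<sigma>)) * exp (z * of_real (\<sigma> + 1 * v) - of_real (exp (\<sigma> + 1 * v))))
      (exp (- (z * of_real \<sigma>)) * (Gamma z /\<^sub>R \<bar>1\<bar>))"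
    by (rule has_bochner_integral_mult_right)
  moreover have "exp (- (z * of_real \<sigma>)) * exp (z * of_real (\<sigma> + 1 * v) - of_real (exp (\<sigma> + 1 * v)))
      = exp (z * of_real v - exp (of_real v + of_real \<sigma>))" for v :: real
    by (simp flip: exp_add exp_of_real of_real_add add: add.commute[of v]) (simp add: algebra_simps)
  ultimately show ?thesis by simp
qed

lemma integrable_exp_minus_exp:
  fixes \<alpha> \<sigma> :: real
  assumes "\<alpha> > 0"
  shows "integrable lborel (\<lambda>v. exp (\<alpha> * v - exp (v + \<sigma>)))"
proof -
  have "integrable lborel (\<lambda>v. norm (exp (of_real \<alpha> * of_real v - exp (of_real v + complex_of_real \<sigma>))))"
    using has_bochner_integral_Gamma_real_shift[of "of_real \<alpha>" \<sigma>] assms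
    by (intro integrable_norm) (auto simp: has_bochner_integral_iff)
  thus ?thesis by (simp only: norm_exp_Gamma_kernel) simp
qed

lemma Gamma_integral_rotated:
  assumes z: "Re z > 0" and s: "\<bar>Im s\<bar> < pi / 2"
  shows "has_bochner_integral lborel (\<lambda>v. exp (z * of_real v - exp (of_real v + s))) (exp (- (z * s)) * Gamma z)"
proof -
  define S where "S = {s. Im s > - (pi / 2)} \<inter> {s. Im s < pi / 2}"
  have S: "open S" "connected S"
    unfolding S_def
    by (intro open_Int open_halfspace_Im_gt open_halfspace_Im_lt)
      (intro convex_connected convex_Int convex_halfspace_Im_gt convex_halfspace_Im_lt)
  let ?f = "\<lambda>s v. exp (z * of_real v - exp (of_real v + s))"
  have meas: "?f s \<in> borel_measurable lborel" for s
    by measurable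
  have dom: "\<exists>r>0. \<exists>g. integrable lborel g \<and> (\<forall>s\<in>cball w r \<inter> S. \<forall>v. norm (?f s v) \<le> g v)"
    if w: "w \<in> S" for w
  proof -
    obtain r where r: "r > 0" "cball w r \<subseteq> S" using S(1) w open_contains_cball by blast
    have "\<exists>s\<in>cball w r. \<forall>t\<in>cball w r. cos (Im s) \<le> cos (Im t)"
      using r by (intro continuous_attains_inf continuous_intros) auto
    then obtain s0 where s0: "s0 \<in> cball w r" "\<And>t. t \<in> cball w r \<Longrightarrow> cos (Im s0) \<le> cos (Im t)" by blast
    have pos: "cos (Im s0) > 0"
      using s0(1) r(2) by (intro cos_gt_zero_pi) (auto simp: S_def subset_iff)
    define \<sigma> where "\<sigma> = Re w - r + ln (cos (Im s0))"
    have "norm (?f s v) \<le> exp (Re z * v - exp (v + \<sigma>))" if s: "s \<in> cball w r" for s v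
    proof -
      have "\<bar>Re s - Re w\<bar> \<le> r"
        using s abs_Re_le_cmod[of "s - w"] by (auto simp: dist_norm norm_minus_commute)
      hence "exp (v + \<sigma>) \<le> exp (v + Re s) * cos (Im s)"
        using s0(2)[OF s] pos unfolding \<sigma>_def
        by (simp add: exp_add mult.assoc[symmetric]) (intro mult_mono, auto)
      thus ?thesis unfolding norm_exp_Gamma_kernel by simp
    qed
    thus ?thesis using r(1) integrable_exp_minus_exp[OF z] by blast
  qed
  have int: "integrable lborel (?f s)" if s: "s \<in> S" for s
  proof -
    obtain r g where g: "integrable lborel g" "\<forall>u\<in>cball s r \<inter> S. \<forall>v. norm (?f u v) \<le> g v" "r > 0"
      using dom[OF s] by blast
    have "norm (?f s v) \<le> norm (g v)" for v
    proof -
      have "s \<in> cball s r \<inter> S" using s g(3) by simp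
      from g(2)[THEN bspec, OF this] have "norm (?f s v) \<le> g v" by blast
      thus ?thesis unfolding real_norm_def by (rule order_trans[OF _ abs_ge_self])
    qed
    thus ?thesis by (intro Bochner_Integration.integrable_bound[OF g(1) meas] AE_I2)
  qed
  let ?d = "\<lambda>s. (\<integral>v. ?f s v \<partial>lborel) - exp (- (z * s)) * Gamma z"
  have "?d s = 0"
  proof (rule analytic_continuation[of ?d S \<real> 0])
    show "?d holomorphic_on S"
      using dom by (intro holomorphic_intros holomorphic_on_lebesgue_integral S meas) auto
    show "(0::complex) islimpt \<real>"
    proof (rule islimptI)
      fix T assume "(0::complex) \<in> T" "open T"
      then obtain e where e: "e > 0" "ball 0 e \<subseteq> T" using open_contains_ball by blast
      thus "\<exists>y\<in>\<real>. y \<in> T \<and> y \<noteq> 0" by (intro bexI[of _ "of_real (e/2)"]) auto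
    qed
    show "?d u = 0" if "u \<in> \<real>" for u
      using that has_bochner_integral_Gamma_real_shift[OF z]
      by (auto simp: Reals_def has_bochner_integral_iff)
  qed (use S s in \<open>auto simp: S_def complex_is_Real_iff\<close>)
  moreover have "s \<in> S" using s by (auto simp: S_def)
  ultimately show ?thesis using int[of s] by (simp add: has_bochner_integral_iff)
qed

subsection \<open>Plancherel's formula and normalization of the kernel\<close>

lemma integrable_lborel_pair_mult:
  fixes f g :: "real \<Rightarrow> complex"
  assumes f: "integrable lborel f" and g: "integrable lborel g"
    and k: "case_prod k \<in> borel_measurable (lborel \<Otimes>\<^sub>M lborel)" "\<And>x y. norm (k x y) \<le> (1::real)"
  shows "integrable (lborel \<Otimes>\<^sub>M lborel) (\<lambda>(x, y). k x y * f x * g y :: complex)"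
proof -
  have [measurable]: "f \<in> borel_measurable lborel" "g \<in> borel_measurable lborel"
    using f g by auto
  note [measurable] = k(1)
  have "integrable (lborel \<Otimes>\<^sub>M lborel) (\<lambda>(x, y). f x * g y)"
    by (rule lborel_pair.Fubini_integrable) (use f g in \<open>auto simp: norm_mult\<close>)
  thus ?thesis
  proof (rule Bochner_Integration.integrable_bound)
    show "AE p in lborel \<Otimes>\<^sub>M lborel. norm (case p of (x, y) \<Rightarrow> k x y * f x * g y)
            \<le> norm (case p of (x, y) \<Rightarrow> f x * g y)"
    proof (rule AE_I2, clarify)
      fix x y
      have "norm (k x y) * (norm (f x) * norm (g y)) \<le> 1 * (norm (f x) * norm (g y))"
        using k(2) by (intro mult_right_mono) auto
      thus "norm (k x y * f x * g y) \<le> norm (f x * g y)" by (simp add: norm_mult mult.assoc)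
    qed
  qed measurable
qed

lemma Fourier_integral_gaussian:
  assumes "\<sigma> > (0::real)"
  shows "(\<integral>t. iexp (t * u) * complex_of_real (sqrt (2 * pi) * std_normal_density (t / \<sigma>)) \<partial>lborel)
           = complex_of_real (2 * pi * \<sigma> * std_normal_density (\<sigma> * u))"
proof -
  have "(\<integral>t. iexp (t * u) * complex_of_real (sqrt (2 * pi) * std_normal_density (t / \<sigma>)) \<partial>lborel)
      = \<bar>\<sigma>\<bar> *\<^sub>R (\<integral>t. iexp ((0 + \<sigma> * t) * u) * complex_of_real (sqrt (2 * pi) * std_normal_density ((0 + \<sigma> * t) / \<sigma>)) \<partial>lborel)"
    using assms by (intro lborel_integral_real_affine) auto
  also have "\<dots> = \<sigma> *\<^sub>R (\<integral>t. sqrt (2 * pi) * (std_normal_density t *\<^sub>R iexp ((\<sigma> * u) * t)) \<partial>lborel)"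
    using assms by (intro arg_cong2[where f = scaleR] Bochner_Integration.integral_cong)
      (auto simp: scaleR_conv_of_real mult_ac)
  also have "\<dots> = \<sigma> *\<^sub>R (sqrt (2 * pi) * char std_normal_distribution (\<sigma> * u))"
    by (subst integral_mult_right_zero) (simp add: char_def integral_density)
  also have "\<dots> = complex_of_real (2 * pi * \<sigma> * std_normal_density (\<sigma> * u))"
    unfolding char_std_normal_distribution unfolding std_normal_density_def scaleR_conv_of_real of_real_mult[symmetric]
    by (intro arg_cong[where f = complex_of_real]) (simp add: real_sqrt_mult field_simps)
  finally show ?thesis .
qed

lemma Fourier_inversion_at_0:
  fixes h :: "real \<Rightarrow> complex" and q :: "real \<Rightarrow> real"
  assumes h: "integrable lborel h" and bnd: "\<And>u. norm (h u) \<le> B" and cont: "isCont h 0"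
    and q: "\<And>t. q t \<ge> 0" and qh: "\<And>t. complex_of_real (q t) = (\<integral>u. iexp (t * u) * h u \<partial>lborel)"
  shows "has_bochner_integral lborel q (2 * pi * Re (h 0))"
proof -
  define \<sigma> where "\<sigma> n = real (Suc n)" for n
  have \<sigma>: "\<sigma> n > 0" for n by (simp add: \<sigma>_def)
  define \<gamma> where "\<gamma> n t = sqrt (2 * pi) * std_normal_density (t / \<sigma> n)" for n t
  have \<gamma>_eq: "\<gamma> n t = exp (- (t / \<sigma> n)\<^sup>2 / 2)" for n t
    by (simp add: \<gamma>_def std_normal_density_def)
  have [measurable]: "h \<in> borel_measurable lborel" "h \<in> borel_measurable borel" using h by auto
  have \<gamma>_int: "integrable lborel (\<lambda>t. complex_of_real (\<gamma> n t))" for n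
  proof -
    have "integrable lborel (\<lambda>t. std_normal_density (0 + (1 / \<sigma> n) * t))"
      using \<sigma>[of n] by (intro lborel_integrable_real_affine) auto
    thus ?thesis unfolding \<gamma>_def by (intro integrable_of_real integrable_mult_right) simp
  qed
  have q_meas [measurable]: "q \<in> borel_measurable borel"
  proof -
    have "q = (\<lambda>t. Re (\<integral>u. iexp (t * u) * h u \<partial>lborel))" using qh by (metis Re_complex_of_real)
    thus ?thesis by simp
  qed
  have F: "integrable (lborel \<Otimes>\<^sub>M lborel) (\<lambda>(t, u). iexp (t * u) * complex_of_real (\<gamma> n t) * h u)" for n
  proof (rule integrable_lborel_pair_mult[OF \<gamma>_int h])
    show "norm (iexp (t * u)) \<le> 1" for t u by (simp del: of_real_mult)
  qed measurable
  have eq1: "(\<integral>u. iexp (t * u) * complex_of_real (\<gamma> n t) * h u \<partial>lborel) = complex_of_real (q t * \<gamma> n t)" for n t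
  proof -
    have "(\<integral>u. iexp (t * u) * complex_of_real (\<gamma> n t) * h u \<partial>lborel)
       = (\<integral>u. complex_of_real (\<gamma> n t) * (iexp (t * u) * h u) \<partial>lborel)"
      by (simp add: mult_ac)
    thus ?thesis by (simp add: qh)
  qed
  have int: "integrable lborel (\<lambda>t. q t * \<gamma> n t)" for n
    using lborel_pair.integrable_fst'[OF F[of n]] by (simp only: prod.case eq1 complex_of_real_integrable_eq)
  have val: "(\<integral>t. q t * \<gamma> n t \<partial>lborel) = Re (2 * pi * (\<integral>s. h (s / \<sigma> n) * std_normal_density s \<partial>lborel))" for n
  proof -
    have "complex_of_real (\<integral>t. q t * \<gamma> n t \<partial>lborel) = (\<integral>t. \<integral>u. iexp (t * u) * complex_of_real (\<gamma> n t) * h u \<partial>lborel \<partial>lborel)"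
      by (simp only: eq1 integral_complex_of_real)
    also have "\<dots> = (\<integral>u. \<integral>t. iexp (t * u) * complex_of_real (\<gamma> n t) * h u \<partial>lborel \<partial>lborel)"
      using F[of n] by (intro lborel_pair.Fubini_integral[symmetric]) simp
    also have "\<dots> = (\<integral>u. complex_of_real (2 * pi * \<sigma> n * std_normal_density (\<sigma> n * u)) * h u \<partial>lborel)"
      using Fourier_integral_gaussian[OF \<sigma>[of n]] by (simp add: \<gamma>_def)
    also have "\<dots> = \<bar>1 / \<sigma> n\<bar> *\<^sub>R (\<integral>s. complex_of_real (2 * pi * \<sigma> n * std_normal_density (\<sigma> n * (0 + 1 / \<sigma> n * s))) * h (0 + 1 / \<sigma> n * s) \<partial>lborel)"
      using \<sigma>[of n] by (intro lborel_integral_real_affine) auto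
    also have "\<dots> = (1 / \<sigma> n) *\<^sub>R (\<integral>s. (2 * pi * \<sigma> n) * (h (s / \<sigma> n) * std_normal_density s) \<partial>lborel)"
      using \<sigma>[of n] by (simp add: mult_ac)
    also have "\<dots> = 2 * pi * (\<integral>s. h (s / \<sigma> n) * std_normal_density s \<partial>lborel)"
      using \<sigma>[of n] by (simp add: scaleR_conv_of_real)
    finally show ?thesis by (metis Re_complex_of_real)
  qed
  have lim: "(\<lambda>n. \<integral>s. h (s / \<sigma> n) * std_normal_density s \<partial>lborel) \<longlonglongrightarrow> (\<integral>s. h 0 * std_normal_density s \<partial>lborel)"
  proof (rule integral_dominated_convergence[where w = "\<lambda>s. B * std_normal_density s"])
    show "AE s in lborel. (\<lambda>n. h (s / \<sigma> n) * std_normal_density s) \<longlonglongrightarrow> h 0 * std_normal_density s"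
    proof (intro AE_I2 tendsto_mult tendsto_const)
      fix s
      have "(\<lambda>n. s / \<sigma> n) \<longlonglongrightarrow> 0"
        unfolding \<sigma>_def by (rule LIMSEQ_Suc[OF lim_const_over_n])
      thus "(\<lambda>n. h (s / \<sigma> n)) \<longlonglongrightarrow> h 0" using cont by (rule isCont_tendsto_compose[rotated])
    qed
    show "AE s in lborel. norm (h (s / \<sigma> n) * std_normal_density s) \<le> B * std_normal_density s" for n
      by (intro AE_I2) (auto simp: norm_mult intro!: mult_right_mono bnd)
  qed auto
  have "(\<integral>s. h 0 * std_normal_density s \<partial>lborel) = h 0" by simp
  with lim have lim': "(\<lambda>n. \<integral>t. q t * \<gamma> n t \<partial>lborel) \<longlonglongrightarrow> Re (2 * pi * h 0)"
    unfolding val by (intro tendsto_intros) simp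
  have mono: "\<gamma> n t \<le> \<gamma> m t" if "n \<le> m" for n m t
    unfolding \<gamma>_eq using that \<sigma>[of n] \<sigma>[of m]
    by (auto simp: power_divide \<sigma>_def intro!: divide_left_mono mult_pos_pos zero_less_power power_mono)
  have conv: "(\<lambda>n. q t * \<gamma> n t) \<longlonglongrightarrow> q t" for t
  proof -
    have "(\<lambda>n. t / \<sigma> n) \<longlonglongrightarrow> 0"
      unfolding \<sigma>_def by (rule LIMSEQ_Suc[OF lim_const_over_n])
    hence "(\<lambda>n. q t * exp (- (t / \<sigma> n)\<^sup>2 / 2)) \<longlonglongrightarrow> q t * exp (- 0\<^sup>2 / 2)" by (intro tendsto_intros) auto
    thus ?thesis by (simp add: \<gamma>_eq)
  qed
  have "integrable lborel q" "(\<integral>t. q t \<partial>lborel) = Re (2 * pi * h 0)"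
    by (rule integral_monotone_convergence_nonneg[OF int _ _ _ lim'];
        use conv q mono in \<open>auto simp: mono_def \<gamma>_eq intro!: mult_left_mono\<close>)+
  thus ?thesis by (simp add: has_bochner_integral_iff)
qed

theorem Plancherel_lborel:
  fixes F :: "real \<Rightarrow> complex"
  assumes F: "integrable lborel F" and bnd: "\<And>v. norm (F v) \<le> B" and cont: "\<And>v. isCont F v"
  shows "has_bochner_integral lborel (\<lambda>t. (norm (\<integral>v. iexp (t * v) * F v \<partial>lborel))\<^sup>2)
           (2 * pi * (\<integral>v. (norm (F v))\<^sup>2 \<partial>lborel))"
proof -
  define h where "h w = (\<integral>v. F v * cnj (F (v - w)) \<partial>lborel)" for w
  have [measurable]: "F \<in> borel_measurable borel" using F by auto
  have [measurable]: "cnj \<in> borel_measurable borel"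
    by (intro borel_measurable_continuous_onI continuous_intros)
  have shift: "integrable lborel (\<lambda>w. F (v - w))" for v
    using lborel_integrable_real_affine[OF F, of "-1" v] by simp
  have shift_norm: "(\<integral>w. norm (F (v - w)) \<partial>lborel) = (\<integral>w. norm (F w) \<partial>lborel)" for v
    using lborel_integral_real_affine[of "-1" "\<lambda>w. norm (F w)" v] by simp
  have pair: "integrable (lborel \<Otimes>\<^sub>M lborel) (\<lambda>(v, w). F v * cnj (F (v - w)))"
  proof (rule lborel_pair.Fubini_integrable)
    show "integrable lborel (\<lambda>v. \<integral>w. norm (case (v, w) of (v, w) \<Rightarrow> F v * cnj (F (v - w))) \<partial>lborel)"
      using F by (simp add: norm_mult shift_norm)
    show "AE v in lborel. integrable lborel (\<lambda>w. case (v, w) of (v, w) \<Rightarrow> F v * cnj (F (v - w)))"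
      using shift by simp
  qed measurable
  have h_int: "integrable lborel h"
    unfolding h_def using lborel_pair.integrable_snd[OF pair] by simp
  have slice: "integrable lborel (\<lambda>v. F v * cnj (F (v - w)))"
    and slice_bnd: "norm (F v * cnj (F (v - w))) \<le> B * norm (F v)" for v w
  proof -
    show le: "norm (F v * cnj (F (v - w))) \<le> B * norm (F v)" for v
      using mult_left_mono[OF bnd[of "v - w"] norm_ge_zero[of "F v"]] by (simp add: norm_mult mult_ac)
    have "integrable lborel (\<lambda>v. B * norm (F v))" using F by simp
    thus "integrable lborel (\<lambda>v. F v * cnj (F (v - w)))"
      by (rule Bochner_Integration.integrable_bound)
        (auto intro!: AE_I2 order_trans[OF le abs_ge_self] simp del: norm_mult complex_mod_mult_cnj)
  qed
  have h_bnd: "norm (h w) \<le> (\<integral>v. B * norm (F v) \<partial>lborel)" for w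
    unfolding h_def using slice slice_bnd F by (intro Bochner_Integration.integral_norm_bound_integral) auto
  have h_cont: "isCont h 0"
    unfolding continuous_at_sequentially o_def
  proof (intro allI impI)
    fix X :: "nat \<Rightarrow> real" assume X: "X \<longlonglongrightarrow> 0"
    show "(\<lambda>n. h (X n)) \<longlonglongrightarrow> h 0"
      unfolding h_def
    proof (rule integral_dominated_convergence[where w = "\<lambda>v. B * norm (F v)"])
      show "AE v in lborel. (\<lambda>n. F v * cnj (F (v - X n))) \<longlonglongrightarrow> F v * cnj (F (v - 0))"
        by (intro AE_I2 tendsto_intros isCont_tendsto_compose[OF cont] X)
    qed (use slice_bnd F in auto)
  qed
  have "complex_of_real ((norm (\<integral>v. iexp (t * v) * F v \<partial>lborel))\<^sup>2) = (\<integral>w. iexp (t * w) * h w \<partial>lborel)" for t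
  proof -
    let ?A = "\<integral>v. iexp (t * v) * F v \<partial>lborel"
    have cnjA: "cnj ?A = (\<integral>w. iexp (- (t * (v - w))) * cnj (F (v - w)) \<partial>lborel)" for v
    proof -
      have "cnj ?A = (\<integral>v. iexp (- (t * v)) * cnj (F v) \<partial>lborel)"
        by (subst Bochner_Integration.integral_cnj[symmetric]) (simp add: exp_cnj)
      also have "\<dots> = \<bar>-1\<bar> *\<^sub>R (\<integral>w. iexp (- (t * (v + (-1) * w))) * cnj (F (v + (-1) * w)) \<partial>lborel)"
        by (rule lborel_integral_real_affine) simp
      finally show ?thesis by simp
    qed
    have pair_t: "integrable (lborel \<Otimes>\<^sub>M lborel) (\<lambda>(v, w). iexp (t * w) * (F v * cnj (F (v - w))))"
      using pair
    proof (rule Bochner_Integration.integrable_bound)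
      show "AE p in lborel \<Otimes>\<^sub>M lborel. norm (case p of (v, w) \<Rightarrow> iexp (t * w) * (F v * cnj (F (v - w))))
          \<le> norm (case p of (v, w) \<Rightarrow> F v * cnj (F (v - w)))"
        by (intro AE_I2, clarify) (simp add: norm_mult del: of_real_mult)
    qed measurable
    have "complex_of_real ((norm ?A)\<^sup>2) = ?A * cnj ?A"
      by (rule complex_norm_square)
    also have "\<dots> = (\<integral>v. iexp (t * v) * F v * cnj ?A \<partial>lborel)" by simp
    also have "\<dots> = (\<integral>v. \<integral>w. iexp (t * w) * (F v * cnj (F (v - w))) \<partial>lborel \<partial>lborel)"
    proof (rule Bochner_Integration.integral_cong[OF refl])
      fix v
      have eq: "iexp (t * v) * F v * (iexp (- (t * (v - w))) * cnj (F (v - w))) = iexp (t * w) * (F v * cnj (F (v - w)))" for w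
      proof -
        have "iexp (t * v) * iexp (- (t * (v - w))) = iexp (t * w)"
          by (simp add: exp_add[symmetric] algebra_simps)
        thus ?thesis by (metis mult.assoc mult.commute)
      qed
      have "iexp (t * v) * F v * cnj ?A = (\<integral>w. iexp (t * v) * F v * (iexp (- (t * (v - w))) * cnj (F (v - w))) \<partial>lborel)"
        unfolding cnjA[of v] by simp
      thus "iexp (t * v) * F v * cnj ?A = (\<integral>w. iexp (t * w) * (F v * cnj (F (v - w))) \<partial>lborel)"
        unfolding eq .
    qed
    also have "\<dots> = (\<integral>w. \<integral>v. iexp (t * w) * (F v * cnj (F (v - w))) \<partial>lborel \<partial>lborel)"
      using pair_t by (rule lborel_pair.Fubini_integral[symmetric])
    also have "\<dots> = (\<integral>w. iexp (t * w) * h w \<partial>lborel)" by (simp add: h_def)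
    finally show ?thesis .
  qed
  hence "has_bochner_integral lborel (\<lambda>t. (norm (\<integral>v. iexp (t * v) * F v \<partial>lborel))\<^sup>2) (2 * pi * Re (h 0))"
    by (intro Fourier_inversion_at_0[OF h_int h_bnd h_cont]) auto
  moreover have "h 0 = complex_of_real (\<integral>v. (norm (F v))\<^sup>2 \<partial>lborel)"
    unfolding h_def integral_complex_of_real[symmetric] complex_norm_square by simp
  ultimately show ?thesis by simp
qed

theorem Gamma_norm_square_Laplace:
  fixes \<alpha> \<theta> :: real
  assumes \<alpha>: "\<alpha> > 0" and \<theta>: "\<bar>\<theta>\<bar> < pi / 2"
  shows "has_bochner_integral lborel (\<lambda>t. (cmod (Gamma (Complex \<alpha> t)))\<^sup>2 * exp (2 * \<theta> * t))
           (2 * pi * (exp (- (2 * \<alpha> * ln (2 * cos \<theta>))) * Gamma (2 * \<alpha>)))"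
proof -
  define F where "F v = exp (complex_of_real \<alpha> * of_real v - exp (of_real v + \<i> * of_real \<theta>))" for v :: real
  have c: "cos \<theta> > 0" using \<theta> by (intro cos_gt_zero_pi) auto
  have normF: "norm (F v) = exp (\<alpha> * v - exp v * cos \<theta>)" for v
    unfolding F_def using norm_exp_Gamma_kernel[of "of_real \<alpha>" v "\<i> * of_real \<theta>"] by simp
  have A: "(\<integral>v. iexp (t * v) * F v \<partial>lborel) = exp (- (Complex \<alpha> t * (\<i> * of_real \<theta>))) * Gamma (Complex \<alpha> t)" for t
  proof -
    have "iexp (t * v) * F v = exp (Complex \<alpha> t * of_real v - exp (of_real v + \<i> * of_real \<theta>))" for v
      unfolding F_def by (simp add: Complex_eq algebra_simps flip: exp_add)
    thus ?thesis
      using Gamma_integral_rotated[of "Complex \<alpha> t" "\<i> * of_real \<theta>"] assms by (simp add: has_bochner_integral_iff)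
  qed
  have "has_bochner_integral lborel (\<lambda>t. (norm (\<integral>v. iexp (t * v) * F v \<partial>lborel))\<^sup>2) (2 * pi * (\<integral>v. (norm (F v))\<^sup>2 \<partial>lborel))"
  proof (rule Plancherel_lborel)
    show "integrable lborel F"
      unfolding F_def using Gamma_integral_rotated[of "of_real \<alpha>" "\<i> * of_real \<theta>"] assms
      by (simp add: has_bochner_integral_iff)
    show "norm (F v) \<le> exp (- (\<alpha> * (1 + ln (cos \<theta> / \<alpha>))))" for v
    proof -
      have "\<alpha> * (1 + (v + ln (cos \<theta> / \<alpha>))) \<le> \<alpha> * exp (v + ln (cos \<theta> / \<alpha>))"
        using \<alpha> exp_ge_add_one_self by (intro mult_left_mono) auto
      also have "\<dots> = exp v * cos \<theta>" using \<alpha> c by (simp add: exp_add)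
      finally show ?thesis unfolding normF by (simp add: algebra_simps)
    qed
    show "isCont F v" for v unfolding F_def by (intro continuous_intros)
  qed
  moreover have "(norm (\<integral>v. iexp (t * v) * F v \<partial>lborel))\<^sup>2 = (cmod (Gamma (Complex \<alpha> t)))\<^sup>2 * exp (2 * \<theta> * t)" for t
  proof -
    have "norm (exp (- (Complex \<alpha> t * (\<i> * of_real \<theta>)))) = exp (\<theta> * t)"
      by (simp add: norm_exp_eq_Re)
    hence "(norm (\<integral>v. iexp (t * v) * F v \<partial>lborel))\<^sup>2 = (exp (\<theta> * t))\<^sup>2 * (cmod (Gamma (Complex \<alpha> t)))\<^sup>2"
      unfolding A norm_mult power_mult_distrib by (simp only:)
    thus ?thesis by (simp add: mult_ac flip: exp_double)
  qed
  moreover have "(\<integral>v. (norm (F v))\<^sup>2 \<partial>lborel) = exp (- (2 * \<alpha> * ln (2 * cos \<theta>))) * Gamma (2 * \<alpha>)"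
  proof -
    let ?s = "ln (2 * cos \<theta>)"
    have sq: "complex_of_real ((norm (F v))\<^sup>2) = exp (of_real (2 * \<alpha>) * of_real v - exp (of_real v + of_real ?s))" for v
    proof -
      have "(norm (F v))\<^sup>2 = exp (2 * \<alpha> * v - exp (v + ?s))"
        unfolding normF using c by (simp add: exp_add algebra_simps flip: exp_double)
      thus ?thesis by (simp flip: exp_of_real)
    qed
    have "complex_of_real (\<integral>v. (norm (F v))\<^sup>2 \<partial>lborel)
        = (\<integral>v. exp (of_real (2 * \<alpha>) * of_real v - exp (of_real v + of_real ?s)) \<partial>lborel)"
      by (simp only: integral_complex_of_real[symmetric] sq)
    also have "\<dots> = exp (- (of_real (2 * \<alpha>) * of_real ?s)) * Gamma (of_real (2 * \<alpha>))"
      using \<alpha> by (intro has_bochner_integral_integral_eq has_bochner_integral_Gamma_real_shift) auto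
    also have "\<dots> = complex_of_real (exp (- (2 * \<alpha> * ?s)) * Gamma (2 * \<alpha>))"
      by (simp flip: exp_of_real Gamma_complex_of_real)
    finally show ?thesis by (simp only: of_real_eq_iff)
  qed
  ultimately show ?thesis by simp
qed

lemma kappa_nonneg: "l > 0 \<Longrightarrow> a > 0 \<Longrightarrow> kappa l a x \<nu> \<ge> 0"
  unfolding kappa_def by (intro mult_nonneg_nonneg divide_nonneg_nonneg) (auto intro: less_imp_le Gamma_real_pos)

theorem has_bochner_integral_kappa:
  assumes l: "l > 0" and a: "a > 0"
  shows "has_bochner_integral lborel (kappa l a x) 1"
proof -
  define \<theta> where "\<theta> = arctan (x / a)"
  define c where "c = l / (2 * a)"
  define C where "C = (2 powr (l - 2) * l) / (pi * Gamma l) * (a powr (l - 1) / (a\<^sup>2 + x\<^sup>2) powr (l / 2))"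
  have c: "c > 0" using l a by (simp add: c_def)
  have \<theta>: "\<bar>\<theta>\<bar> < pi / 2" unfolding \<theta>_def using arctan_bounded[of "x / a"] by (auto simp: abs_less_iff)
  let ?I = "2 * pi * (exp (- (2 * (l / 2) * ln (2 * cos \<theta>))) * Gamma (2 * (l / 2)))"
  have "has_bochner_integral lborel (\<lambda>\<nu>. (cmod (Gamma (Complex (l / 2) (0 + c * \<nu>))))\<^sup>2 * exp (2 * \<theta> * (0 + c * \<nu>)))
          (?I /\<^sub>R \<bar>c\<bar>)"
    by (rule lborel_has_bochner_integral_real_affine_iff[THEN iffD1])
      (use Gamma_norm_square_Laplace[OF _ \<theta>, of "l / 2"] l c in auto)
  hence "has_bochner_integral lborel (\<lambda>\<nu>. C * ((cmod (Gamma (Complex (l / 2) (0 + c * \<nu>))))\<^sup>2 * exp (2 * \<theta> * (0 + c * \<nu>))))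
          (C * (?I /\<^sub>R \<bar>c\<bar>))"
    by (rule has_bochner_integral_mult_right)
  moreover have "C * ((cmod (Gamma (Complex (l / 2) (0 + c * \<nu>))))\<^sup>2 * exp (2 * \<theta> * (0 + c * \<nu>))) = kappa l a x \<nu>" for \<nu>
  proof -
    have "Complex (l / 2) (0 + c * \<nu>) = (complex_of_real (l * a) + \<i> * complex_of_real (l * \<nu>)) / complex_of_real (2 * a)"
      using a by (auto simp: complex_eq_iff c_def)
    moreover have "2 * \<theta> * (0 + c * \<nu>) = l * \<nu> / a * arctan (x / a)"
      using a by (simp add: c_def \<theta>_def)
    ultimately show ?thesis by (simp only: kappa_def C_def mult.assoc)
  qed
  moreover have "C * (?I /\<^sub>R \<bar>c\<bar>) = 1"
  proof -
    have pos: "a\<^sup>2 + x\<^sup>2 > 0" using a by (simp add: add_pos_nonneg)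
    have "cos \<theta> = a / sqrt (a\<^sup>2 + x\<^sup>2)"
    proof -
      have "1 + (x / a)\<^sup>2 = (a\<^sup>2 + x\<^sup>2) / a\<^sup>2" using a by (simp add: field_simps)
      thus ?thesis using a by (simp add: \<theta>_def cos_arctan real_sqrt_divide)
    qed
    hence L: "ln (2 * cos \<theta>) = ln 2 + ln a - ln (a\<^sup>2 + x\<^sup>2) / 2"
      using a pos by (simp add: ln_mult ln_div ln_sqrt)
    have "C * (?I /\<^sub>R \<bar>c\<bar>) = (2 * pi * Gamma l * l / (pi * Gamma l) / c) *
        (exp ((l - 2) * ln 2) * (exp ((l - 1) * ln a) / exp (l / 2 * ln (a\<^sup>2 + x\<^sup>2)))
         * exp (- (l * ln (2 * cos \<theta>))))"
      using a pos c by (simp add: C_def powr_def field_simps)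
    also have "exp ((l - 2) * ln 2) * (exp ((l - 1) * ln a) / exp (l / 2 * ln (a\<^sup>2 + x\<^sup>2)))
         * exp (- (l * ln (2 * cos \<theta>))) = exp (- 2 * ln 2 - ln a)"
      unfolding L by (simp add: algebra_simps flip: exp_add exp_diff)
    also have "\<dots> = 1 / (4 * a)"
      using a by (simp add: exp_diff exp_minus field_simps exp_double flip: exp_add)
    also have "(2 * pi * Gamma l * l / (pi * Gamma l) / c) * (1 / (4 * a)) = 1"
      using l a less_imp_neq[OF Gamma_real_pos[OF l]] by (simp add: c_def field_simps)
    finally show ?thesis .
  qed
  ultimately show ?thesis by simp
qed

subsection \<open>Analytic continuation of the kernel\<close>

text \<open>\<open>kernel_ratio\<close> continues \<open>kappa l a y \<nu> / kappa l a x \<nu>\<close> to complex \<open>y\<close>; \<open>kernel_angle\<close> and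
  \<open>kernel_potential\<close> are primitives of \<open>1 / (a\<^sup>2 + w\<^sup>2)\<close> and \<open>(w - x) / (a\<^sup>2 + w\<^sup>2)\<close>.\<close>

definition kernel_angle :: "real \<Rightarrow> complex \<Rightarrow> complex" where
  "kernel_angle a w = Arctan (w / of_real a) / of_real a"

definition kernel_potential :: "real \<Rightarrow> real \<Rightarrow> complex \<Rightarrow> complex" where
  "kernel_potential a x w = Ln ((of_real a)\<^sup>2 + w\<^sup>2) / 2 - of_real x * kernel_angle a w"

definition kernel_ratio :: "real \<Rightarrow> real \<Rightarrow> real \<Rightarrow> complex \<Rightarrow> real \<Rightarrow> complex" where
  "kernel_ratio l a x w \<nu> = exp (of_real l *
     (of_real (\<nu> - x) * (kernel_angle a w - kernel_angle a (of_real x))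
      - (kernel_potential a x w - kernel_potential a x (of_real x))))"

lemma square_add_pos: "a > 0 \<Longrightarrow> (a::real)\<^sup>2 + y\<^sup>2 > 0"
  by (simp add: add_pos_nonneg)

lemma kernel_angle_of_real: "kernel_angle a (of_real y) = of_real (arctan (y / a) / a)"
proof -
  have "Arctan (of_real (y / a)) = of_real (arctan (y / a))"
    by (rule complex_eqI) (simp_all add: arctan_eq_Re_Arctan del: of_real_divide)
  thus ?thesis by (simp add: kernel_angle_def)
qed

lemma kernel_potential_of_real:
  assumes "a > 0"
  shows "kernel_potential a x (of_real y) = of_real (ln (a\<^sup>2 + y\<^sup>2) / 2 - x * (arctan (y / a) / a))"
proof -
  have "Ln ((of_real a)\<^sup>2 + (of_real y)\<^sup>2) = of_real (ln (a\<^sup>2 + y\<^sup>2))"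
    using Ln_of_real[OF square_add_pos[OF assms, of y]] by simp
  thus ?thesis by (simp add: kernel_potential_def kernel_angle_of_real)
qed

lemma kappa_eq_kernel_ratio:
  assumes a: "a > 0"
  shows "complex_of_real (kappa l a y \<nu>) = of_real (kappa l a x \<nu>) * kernel_ratio l a x (of_real y) \<nu>"
proof -
  define H where "H y = arctan (y / a) / a" for y
  define L where "L y = ln (a\<^sup>2 + y\<^sup>2)" for y
  define E where "E = l * ((\<nu> - x) * (H y - H x) - ((L y / 2 - x * H y) - (L x / 2 - x * H x)))"
  have ratio: "kernel_ratio l a x (of_real y) \<nu> = of_real (exp E)"
    unfolding kernel_ratio_def kernel_angle_of_real kernel_potential_of_real[OF a] E_def H_def L_def
    by (simp flip: exp_of_real)
  have "exp (l * \<nu> * H y) / exp (l / 2 * L y) = exp (l * \<nu> * H x) / exp (l / 2 * L x) * exp E"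
    unfolding E_def by (simp flip: exp_add exp_diff) (simp add: field_simps)
  moreover define K where "K = (2 powr (l - 2) * l) / (pi * Gamma l) * a powr (l - 1)
     * (cmod (Gamma ((complex_of_real (l * a) + \<i> * complex_of_real (l * \<nu>)) / complex_of_real (2 * a))))\<^sup>2"
  have "kappa l a y \<nu> = K * (exp (l * \<nu> * H y) / exp (l / 2 * L y))" for y
    using square_add_pos[OF a, of y] by (simp add: kappa_def powr_def H_def L_def K_def)
  ultimately have "kappa l a y \<nu> = kappa l a x \<nu> * exp E" by (simp only: mult.assoc)
  thus ?thesis by (simp add: ratio)
qed

lemma kernel_strip:
  fixes w :: complex
  assumes "a > 0" "\<bar>Im w\<bar> < a"
  shows "Re ((of_real a)\<^sup>2 + w\<^sup>2) > 0" "(of_real a)\<^sup>2 + w\<^sup>2 \<noteq> 0" "\<bar>Im (w / of_real a)\<bar> < 1"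
proof -
  have "(Im w)\<^sup>2 < a\<^sup>2" using assms by (metis abs_ge_zero power2_abs power_strict_mono zero_less_numeral)
  thus pos: "Re ((of_real a)\<^sup>2 + w\<^sup>2) > 0"
  proof -
    have "Re ((of_real a)\<^sup>2 + w\<^sup>2) = a\<^sup>2 + (Re w)\<^sup>2 - (Im w)\<^sup>2" by (simp add: power2_eq_square)
    thus ?thesis using \<open>(Im w)\<^sup>2 < a\<^sup>2\<close> zero_le_power2[of "Re w"] by linarith
  qed
  thus "(of_real a)\<^sup>2 + w\<^sup>2 \<noteq> 0" by fastforce
  show "\<bar>Im (w / of_real a)\<bar> < 1" using assms by (simp add: Im_divide_of_real)
qed

lemma DERIV_kernel_angle:
  assumes "a > 0" "\<bar>Im w\<bar> < a"
  shows "(kernel_angle a has_field_derivative 1 / ((of_real a)\<^sup>2 + w\<^sup>2)) (at w)"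
proof -
  have "((\<lambda>w. Arctan (w / of_real a) / of_real a) has_field_derivative
      inverse (1 + (w / of_real a)\<^sup>2) * (1 / of_real a) / of_real a) (at w)"
    by (rule DERIV_cdivide, rule DERIV_chain2[OF has_field_derivative_Arctan])
      (use assms(1) kernel_strip(3)[OF assms] in \<open>auto intro!: derivative_eq_intros\<close>)
  also have "inverse (1 + (w / of_real a)\<^sup>2) * (1 / of_real a) / of_real a = 1 / ((of_real a)\<^sup>2 + w\<^sup>2)"
  proof -
    have "1 + (w / of_real a)\<^sup>2 = ((of_real a)\<^sup>2 + w\<^sup>2) / (of_real a)\<^sup>2"
      using assms by (simp add: power_divide add_divide_distrib)
    moreover have "a \<noteq> 0" using assms by simp
    ultimately show ?thesis by (simp add: power2_eq_square)
  qed
  finally show ?thesis unfolding kernel_angle_def[abs_def] .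
qed

lemma DERIV_kernel_potential:
  assumes "a > 0" "\<bar>Im w\<bar> < a"
  shows "(kernel_potential a x has_field_derivative (w - of_real x) / ((of_real a)\<^sup>2 + w\<^sup>2)) (at w)"
proof -
  have "(of_real a)\<^sup>2 + w\<^sup>2 \<notin> \<real>\<^sub>\<le>\<^sub>0"
    using kernel_strip(1)[OF assms] by (auto simp: complex_nonpos_Reals_iff)
  hence "((\<lambda>w. Ln ((of_real a)\<^sup>2 + w\<^sup>2) / 2 - of_real x * kernel_angle a w) has_field_derivative
      inverse ((of_real a)\<^sup>2 + w\<^sup>2) * w - of_real x * (1 / ((of_real a)\<^sup>2 + w\<^sup>2))) (at w)"
    by (auto intro!: derivative_eq_intros DERIV_kernel_angle[OF assms])
  moreover have "inverse A * w - u * (1 / A) = (w - u) / A" for A u :: complex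
    by (simp add: divide_inverse algebra_simps)
  ultimately show ?thesis unfolding kernel_potential_def[abs_def] by (simp only:)
qed

lemma norm_kernel_denominator_ge:
  assumes a: "a > 0" and w: "\<bar>Im w\<bar> \<le> a / 2"
  shows "norm ((of_real a)\<^sup>2 + w\<^sup>2) \<ge> a\<^sup>2 / 2"
proof -
  have "(Im w)\<^sup>2 \<le> (a / 2)\<^sup>2" using w by (metis abs_ge_zero power2_abs power_mono)
  hence "a\<^sup>2 / 2 \<le> a\<^sup>2 + (Re w)\<^sup>2 - (Im w)\<^sup>2" by (simp add: power_divide) (smt (verit) zero_le_power2)
  also have "\<dots> = Re ((of_real a)\<^sup>2 + w\<^sup>2)" by (simp add: power2_eq_square)
  also have "\<dots> \<le> norm ((of_real a)\<^sup>2 + w\<^sup>2)" by (rule complex_Re_le_cmod)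
  finally show ?thesis .
qed

lemma kernel_increments:
  assumes a: "a > 0" and w: "w \<in> cball (of_real x) (a / 2)"
  shows "norm (kernel_angle a w - kernel_angle a (of_real x)) \<le> 2 / a\<^sup>2 * norm (w - of_real x)"
    and "norm (kernel_potential a x w - kernel_potential a x (of_real x)) \<le> 2 / a\<^sup>2 * (norm (w - of_real x))\<^sup>2"
proof -
  define S where "S = cball (complex_of_real x) (norm (w - of_real x))"
  have le: "norm (w - of_real x) \<le> a / 2" using w by (simp add: dist_norm norm_minus_commute)
  have Im: "\<bar>Im z\<bar> \<le> a / 2" if "z \<in> S" for z
    using that le abs_Im_le_cmod[of "z - of_real x"] by (simp add: S_def dist_norm norm_minus_commute)
  have Im': "\<bar>Im z\<bar> < a" if "z \<in> S" for z using Im[OF that] a by simp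
  have inv: "norm (1 / ((of_real a)\<^sup>2 + z\<^sup>2)) \<le> 2 / a\<^sup>2" if "z \<in> S" for z
  proof -
    have "1 / norm ((of_real a)\<^sup>2 + z\<^sup>2) \<le> 1 / (a\<^sup>2 / 2)"
      by (rule divide_left_mono[OF norm_kernel_denominator_ge[OF a Im[OF that]]])
        (use a kernel_strip(2)[OF a Im'[OF that]] in \<open>auto intro!: mult_pos_pos\<close>)
    thus ?thesis by (simp add: norm_divide)
  qed
  have S: "convex S" "w \<in> S" "of_real x \<in> S" by (auto simp: S_def dist_norm norm_minus_commute)
  show "norm (kernel_angle a w - kernel_angle a (of_real x)) \<le> 2 / a\<^sup>2 * norm (w - of_real x)"
    by (rule field_differentiable_bound[OF S(1)
          has_field_derivative_at_within[OF DERIV_kernel_angle[OF a Im']] inv S(2,3)])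
  have inv': "norm ((z - of_real x) / ((of_real a)\<^sup>2 + z\<^sup>2)) \<le> norm (w - of_real x) * (2 / a\<^sup>2)" if "z \<in> S" for z
  proof -
    have "norm ((z - of_real x) * (1 / ((of_real a)\<^sup>2 + z\<^sup>2))) \<le> norm (w - of_real x) * (2 / a\<^sup>2)"
      unfolding norm_mult using inv[OF that] that
      by (intro mult_mono) (auto simp: S_def dist_norm norm_minus_commute)
    thus ?thesis by simp
  qed
  have "norm (kernel_potential a x w - kernel_potential a x (of_real x))
      \<le> norm (w - of_real x) * (2 / a\<^sup>2) * norm (w - of_real x)"
    by (rule field_differentiable_bound[OF S(1)
          has_field_derivative_at_within[OF DERIV_kernel_potential[OF a Im']] inv' S(2,3)])
  thus "norm (kernel_potential a x w - kernel_potential a x (of_real x)) \<le> 2 / a\<^sup>2 * (norm (w - of_real x))\<^sup>2"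
    by (simp add: power2_eq_square mult_ac)
qed

lemma norm_kernel_ratio_le:
  assumes a: "a > 0" and l: "l > 0" and M: "M \<ge> 0" "M / sqrt l \<le> a / 2"
    and w: "w \<in> cball (of_real x) (M / sqrt l)"
  shows "norm (kernel_ratio l a x w \<nu>) \<le> exp (2 / a\<^sup>2 * M\<^sup>2) * exp (2 / a\<^sup>2 * M * (sqrt l * \<bar>\<nu> - x\<bar>))"
proof -
  let ?d = "norm (w - of_real x)"
  have d: "?d \<le> M / sqrt l" using w unfolding mem_cball dist_norm by (subst norm_minus_commute)
  have wa: "w \<in> cball (of_real x) (a / 2)" using w subset_cball[OF M(2)] by blast
  let ?A = "kernel_angle a w - kernel_angle a (of_real x)"
  let ?P = "kernel_potential a x w - kernel_potential a x (of_real x)"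
  have A: "norm ?A \<le> 2 / a\<^sup>2 * (M / sqrt l)"
    by (rule order_trans[OF kernel_increments(1)[OF a wa] mult_left_mono[OF d]]) simp
  have P: "norm ?P \<le> 2 / a\<^sup>2 * (M / sqrt l)\<^sup>2"
    by (rule order_trans[OF kernel_increments(2)[OF a wa] mult_left_mono[OF power_mono[OF d]]]) auto
  have "norm (of_real l * (of_real (\<nu> - x) * ?A - ?P)) = l * norm (of_real (\<nu> - x) * ?A - ?P)"
    unfolding norm_mult[of "of_real l"] using l by simp
  also have "\<dots> \<le> l * (norm (of_real (\<nu> - x) * ?A) + norm ?P)"
    using l by (intro mult_left_mono norm_triangle_ineq4) auto
  also have "\<dots> = l * (\<bar>\<nu> - x\<bar> * norm ?A + norm ?P)"
    unfolding norm_mult norm_of_real ..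
  also have "\<dots> \<le> l * (\<bar>\<nu> - x\<bar> * (2 / a\<^sup>2 * (M / sqrt l)) + 2 / a\<^sup>2 * (M / sqrt l)\<^sup>2)"
    using l by (intro mult_left_mono add_mono A P) auto
  also have "\<dots> = 2 / a\<^sup>2 * M\<^sup>2 + 2 / a\<^sup>2 * M * (sqrt l * \<bar>\<nu> - x\<bar>)"
  proof -
    have 1: "l * (M / sqrt l) = M * sqrt l" using l real_div_sqrt[of l] by (simp add: field_simps)
    have 2: "l * (M / sqrt l)\<^sup>2 = M\<^sup>2" using l by (simp add: power_divide)
    have 3: "l * (u * (k * m) + k * q) = k * (l * q) + k * (l * m) * u" for u k m q :: real
      by (simp add: algebra_simps)
    show ?thesis unfolding 3 1 2 by (simp only: mult.assoc)
  qed
  finally have "norm (of_real l * (of_real (\<nu> - x) * ?A - ?P))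
      \<le> 2 / a\<^sup>2 * M\<^sup>2 + 2 / a\<^sup>2 * M * (sqrt l * \<bar>\<nu> - x\<bar>)" .
  thus ?thesis unfolding kernel_ratio_def exp_add[symmetric]
    by (intro order_trans[OF norm_exp]) (simp only: exp_le_cancel_iff)
qed

subsection \<open>Exponential moments\<close>

lemma kappa_tilt_le:
  assumes a: "a > 0" and l: "l > 0" and y: "\<bar>y - x\<bar> \<le> a / 2"
  shows "kappa l a x \<nu> * exp (l * (\<nu> - x) * (arctan (y / a) / a - arctan (x / a) / a))
           \<le> exp (l * (2 / a\<^sup>2 * (y - x)\<^sup>2)) * kappa l a y \<nu>"
proof -
  define H where "H = arctan (y / a) / a - arctan (x / a) / a"
  define P where "P = Re (kernel_potential a x (of_real y) - kernel_potential a x (of_real x))"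
  have "norm (kernel_potential a x (of_real y) - kernel_potential a x (of_real x)) \<le> 2 / a\<^sup>2 * (norm (of_real y - complex_of_real x))\<^sup>2"
    using y by (intro kernel_increments(2)[OF a]) (simp add: dist_real_def abs_minus_commute flip: of_real_diff)
  also have "(norm (of_real y - complex_of_real x))\<^sup>2 = (y - x)\<^sup>2" by (simp flip: of_real_diff)
  finally have P: "P \<le> 2 / a\<^sup>2 * (y - x)\<^sup>2"
    unfolding P_def by (rule order_trans[OF complex_Re_le_cmod])
  have "kernel_angle a (of_real y) - kernel_angle a (of_real x) = of_real H"
    by (simp add: kernel_angle_of_real H_def)
  hence "norm (kernel_ratio l a x (of_real y) \<nu>) = exp (l * ((\<nu> - x) * H - P))"
    unfolding kernel_ratio_def norm_exp_eq_Re P_def by (simp flip: of_real_mult of_real_diff)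
  moreover have "norm (complex_of_real (kappa l a y \<nu>)) = kappa l a x \<nu> * norm (kernel_ratio l a x (of_real y) \<nu>)"
    unfolding kappa_eq_kernel_ratio[OF a, of l y \<nu> x] norm_mult norm_of_real
    using kappa_nonneg[OF l a] by simp
  ultimately have "kappa l a y \<nu> = kappa l a x \<nu> * exp (l * ((\<nu> - x) * H - P))"
    using kappa_nonneg[OF l a, of y \<nu>] by simp
  hence "exp (l * P) * kappa l a y \<nu> = kappa l a x \<nu> * exp (l * (\<nu> - x) * H)"
    by (simp add: exp_add[symmetric] right_diff_distrib mult.assoc)
  moreover have "exp (l * P) * kappa l a y \<nu> \<le> exp (l * (2 / a\<^sup>2 * (y - x)\<^sup>2)) * kappa l a y \<nu>"
    using l by (intro mult_right_mono iffD2[OF exp_le_cancel_iff] mult_left_mono P kappa_nonneg a) auto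
  ultimately show ?thesis by (simp add: H_def)
qed

lemma eventually_angle_increment_ge:
  fixes a x c :: real
  assumes a: "a > 0" and c: "c \<noteq> 0"
  shows "\<forall>\<^sub>F l in at_top. (arctan ((x + c / sqrt l) / a) / a - arctan (x / a) / a) / (c / sqrt l) \<ge> 1 / (2 * (a\<^sup>2 + x\<^sup>2))"
proof -
  have pos: "a\<^sup>2 + x\<^sup>2 > 0" using square_add_pos[OF a] .
  have der: "((\<lambda>y. arctan (y / a) / a) has_real_derivative 1 / (a\<^sup>2 + x\<^sup>2)) (at x)"
  proof -
    have "((\<lambda>y. arctan (y / a) / a) has_real_derivative inverse (1 + (x / a)\<^sup>2) * (1 / a) / a) (at x)"
      by (auto intro!: derivative_eq_intros simp: divide_inverse)
    also have "inverse (1 + (x / a)\<^sup>2) * (1 / a) / a = 1 / (a\<^sup>2 + x\<^sup>2)"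
      using a pos by (simp add: divide_simps power2_eq_square)
    finally show ?thesis .
  qed
  have half: "1 / (2 * q) < 1 / q" if "q > 0" for q :: real using that by (simp add: field_simps)
  have ev: "\<forall>\<^sub>F h in at 0. (arctan ((x + h) / a) / a - arctan (x / a) / a) / h > 1 / (2 * (a\<^sup>2 + x\<^sup>2))"
    by (rule order_tendstoD(1)[OF der[unfolded DERIV_def] half[OF pos]])
  have "filterlim (\<lambda>l. c / sqrt l) (at 0) at_top"
    unfolding filterlim_at
  proof
    show "((\<lambda>l. c / sqrt l) \<longlongrightarrow> 0) at_top"
      by (rule tendsto_divide_0[OF tendsto_const filterlim_at_top_imp_at_infinity[OF sqrt_at_top]])
    show "\<forall>\<^sub>F l in at_top. c / sqrt l \<in> UNIV \<and> c / sqrt l \<noteq> 0"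
      using eventually_gt_at_top[of 0] by eventually_elim (use c in auto)
  qed
  from eventually_compose_filterlim[OF ev this] show ?thesis
    by (rule eventually_mono) (rule less_imp_le)
qed

theorem kappa_exponential_moment:
  fixes a x D :: real
  assumes a: "a > 0" and D: "D > 0"
  shows "\<exists>B. \<forall>\<^sub>F l in at_top. integrable lborel (\<lambda>\<nu>. kappa l a x \<nu> * exp (D * (sqrt l * \<bar>\<nu> - x\<bar>)))
           \<and> (\<integral>\<nu>. kappa l a x \<nu> * exp (D * (sqrt l * \<bar>\<nu> - x\<bar>)) \<partial>lborel) \<le> B"
proof -
  have sq: "a\<^sup>2 + x\<^sup>2 > 0" using square_add_pos[OF a] .
  define c where "c = 2 * D * (a\<^sup>2 + x\<^sup>2)"
  have c: "c > 0" using D sq by (simp add: c_def)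
  define E where "E = exp (2 / a\<^sup>2 * c\<^sup>2)"
  have 1: "\<forall>\<^sub>F l in at_top. (arctan ((x + c / sqrt l) / a) / a - arctan (x / a) / a) / (c / sqrt l) \<ge> 1 / (2 * (a\<^sup>2 + x\<^sup>2))"
    using c by (intro eventually_angle_increment_ge a) auto
  have 2: "\<forall>\<^sub>F l in at_top. (arctan ((x + (- c) / sqrt l) / a) / a - arctan (x / a) / a) / ((- c) / sqrt l) \<ge> 1 / (2 * (a\<^sup>2 + x\<^sup>2))"
    using c by (intro eventually_angle_increment_ge a) auto
  have "\<forall>\<^sub>F l in at_top. integrable lborel (\<lambda>\<nu>. kappa l a x \<nu> * exp (D * (sqrt l * \<bar>\<nu> - x\<bar>)))
           \<and> (\<integral>\<nu>. kappa l a x \<nu> * exp (D * (sqrt l * \<bar>\<nu> - x\<bar>)) \<partial>lborel) \<le> 2 * E"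
    using 1 2 eventually_gt_at_top[of 0] eventually_ge_at_top[of "(2 * c / a)\<^sup>2"]
  proof eventually_elim
    case (elim l)
    have l: "l > 0" and sl: "sqrt l > 0" using elim by auto
    have small: "\<bar>(x + s * c / sqrt l) - x\<bar> \<le> a / 2" if "\<bar>s\<bar> = 1" for s
    proof -
      have "2 * c / a \<le> sqrt l" using elim(4) by (rule real_le_rsqrt)
      hence "c / sqrt l \<le> a / 2" using a sl by (simp add: field_simps)
      thus ?thesis using c sl that by (simp add: abs_mult)
    qed
    have tilt: "kappa l a x \<nu> * exp (D * (sqrt l * (s * (\<nu> - x)))) \<le> E * kappa l a (x + s * c / sqrt l) \<nu>"
      if s: "\<bar>s\<bar> = 1" and pos: "s * (\<nu> - x) \<ge> 0" for s \<nu>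
    proof -
      define H where "H = arctan ((x + s * c / sqrt l) / a) / a - arctan (x / a) / a"
      have ss: "s * s = 1" using s by (auto simp: abs_if split: if_splits)
      have "H / (s * c / sqrt l) \<ge> 1 / (2 * (a\<^sup>2 + x\<^sup>2))"
        using s elim(1,2) unfolding H_def by (auto simp: abs_if split: if_splits)
      hence "c / sqrt l * (1 / (2 * (a\<^sup>2 + x\<^sup>2))) \<le> c / sqrt l * (H / (s * c / sqrt l))"
        using c sl by (intro mult_left_mono) auto
      also have "\<dots> = H / s" using c sl by simp
      also have "H / s = s * H" using ss by (simp add: divide_eq_eq mult_ac)
      also have "c / sqrt l * (1 / (2 * (a\<^sup>2 + x\<^sup>2))) = D / sqrt l"
      proof -
        have "2 * D * q / r * (1 / (2 * q)) = D / r" if "q > 0" for q r :: real using that by simp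
        thus ?thesis unfolding c_def using sq by blast
      qed
      finally have "D / sqrt l \<le> s * H" .
      hence "l * (s * (\<nu> - x)) * (D / sqrt l) \<le> l * (s * (\<nu> - x)) * (s * H)"
        using l pos by (intro mult_left_mono) auto
      also have "\<dots> = l * (\<nu> - x) * H" using ss by (metis mult.assoc mult.commute mult.left_neutral)
      also have "l * (s * (\<nu> - x)) * (D / sqrt l) = D * (sqrt l * (s * (\<nu> - x)))"
        using l real_div_sqrt[of l] by (simp add: field_simps)
      finally have "D * (sqrt l * (s * (\<nu> - x))) \<le> l * (\<nu> - x) * H" .
      hence "kappa l a x \<nu> * exp (D * (sqrt l * (s * (\<nu> - x)))) \<le> kappa l a x \<nu> * exp (l * (\<nu> - x) * H)"
        using kappa_nonneg[OF l a] by (intro mult_left_mono) auto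
      also have "\<dots> \<le> exp (l * (2 / a\<^sup>2 * ((x + s * c / sqrt l) - x)\<^sup>2)) * kappa l a (x + s * c / sqrt l) \<nu>"
        unfolding H_def by (rule kappa_tilt_le[OF a l small[OF s]])
      also have "l * (2 / a\<^sup>2 * ((x + s * c / sqrt l) - x)\<^sup>2) = 2 / a\<^sup>2 * c\<^sup>2"
        using l ss by (simp add: power_divide power_mult_distrib power2_eq_square[of s])
      finally show ?thesis unfolding E_def .
    qed
    let ?g = "\<lambda>\<nu>. E * kappa l a (x + 1 * c / sqrt l) \<nu> + E * kappa l a (x + (-1) * c / sqrt l) \<nu>"
    have g: "has_bochner_integral lborel ?g (E * 1 + E * 1)"
      by (intro has_bochner_integral_add has_bochner_integral_mult_right has_bochner_integral_kappa l a)
    have le: "kappa l a x \<nu> * exp (D * (sqrt l * \<bar>\<nu> - x\<bar>)) \<le> ?g \<nu>" for \<nu>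
    proof -
      have nn: "E * kappa l a y \<nu> \<ge> 0" for y using kappa_nonneg[OF l a] by (simp add: E_def)
      show ?thesis
      proof (cases "\<nu> \<ge> x")
        case True
        thus ?thesis using tilt[of 1 \<nu>] nn[of "x + (-1) * c / sqrt l"] by simp
      next
        case False
        thus ?thesis using tilt[of "-1" \<nu>] nn[of "x + 1 * c / sqrt l"] by simp
      qed
    qed
    have meas: "kappa l a x \<in> borel_measurable borel"
      using has_bochner_integral_kappa[OF l a, of x] by (auto simp: has_bochner_integral_iff)
    have int: "integrable lborel (\<lambda>\<nu>. kappa l a x \<nu> * exp (D * (sqrt l * \<bar>\<nu> - x\<bar>)))"
    proof (rule Bochner_Integration.integrable_bound[of lborel ?g])
      show "integrable lborel ?g" using g by (simp add: has_bochner_integral_iff)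
      show "AE \<nu> in lborel. norm (kappa l a x \<nu> * exp (D * (sqrt l * \<bar>\<nu> - x\<bar>))) \<le> norm (?g \<nu>)"
      proof (rule AE_I2)
        fix \<nu>
        have "norm (kappa l a x \<nu> * exp (D * (sqrt l * \<bar>\<nu> - x\<bar>))) = kappa l a x \<nu> * exp (D * (sqrt l * \<bar>\<nu> - x\<bar>))"
          using kappa_nonneg[OF l a, of x \<nu>] by (simp add: abs_mult)
        thus "norm (kappa l a x \<nu> * exp (D * (sqrt l * \<bar>\<nu> - x\<bar>))) \<le> norm (?g \<nu>)"
          using order_trans[OF le abs_ge_self] by (simp only: real_norm_def)
      qed
    qed (use meas in measurable)
    have "(\<integral>\<nu>. kappa l a x \<nu> * exp (D * (sqrt l * \<bar>\<nu> - x\<bar>)) \<partial>lborel) \<le> integral\<^sup>L lborel ?g"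
      using int g le by (intro integral_mono) (auto simp: has_bochner_integral_iff)
    also have "\<dots> = 2 * E" using g by (simp add: has_bochner_integral_iff)
    finally show ?case using int by simp
  qed
  thus ?thesis by blast
qed

lemma power_le_fact_exp: "t \<ge> 0 \<Longrightarrow> t ^ n \<le> fact n * exp (t::real)"
proof -
  assume t: "t \<ge> 0"
  have "sum (\<lambda>k. t ^ k /\<^sub>R fact k) {n} \<le> (\<Sum>k. t ^ k /\<^sub>R fact k)"
    using t by (intro sum_le_suminf summable_exp_generic) auto
  thus ?thesis by (simp add: exp_def field_simps)
qed

lemma nth_deriv_exists_imp_differentiable:
  "nth_deriv_exists (Suc n) f y \<Longrightarrow> f differentiable (at y)"
proof (induction n arbitrary: y)
  case (Suc n)
  hence "\<forall>\<^sub>F z in nhds y. nth_deriv_exists (Suc n) f z" by simp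
  from eventually_nhds_x_imp_x[OF this] Suc.IH show ?case by blast
qed auto

lemma nth_deriv_exists_deriv:
  "nth_deriv_exists (Suc n) f y \<Longrightarrow> nth_deriv_exists n (deriv f) y"
proof (induction n arbitrary: y)
  case (Suc n)
  thus ?case by (auto simp: funpow_swap1 elim: eventually_mono)
qed auto

theorem Taylor_Peano:
  fixes f :: "real \<Rightarrow> real"
  assumes "nth_deriv_exists (Suc n) f x" and "\<epsilon> > 0"
  shows "\<exists>\<delta>>0. \<forall>y. \<bar>y - x\<bar> < \<delta> \<longrightarrow>
           \<bar>f y - (\<Sum>j\<le>Suc n. (deriv ^^ j) f x / fact j * (y - x) ^ j)\<bar> \<le> \<epsilon> * \<bar>y - x\<bar> ^ Suc n"
  using assms
proof (induction n arbitrary: f)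
  case 0
  hence "(f has_real_derivative deriv f x) (at x)"
    by (simp add: DERIV_deriv_iff_real_differentiable)
  hence "(\<lambda>h. (f (x + h) - f x) / h) \<midarrow>0\<rightarrow> deriv f x" by (simp add: DERIV_def)
  from LIM_D[OF this 0(2)] obtain \<delta> where \<delta>: "\<delta> > 0"
    "\<And>h. h \<noteq> 0 \<Longrightarrow> \<bar>h\<bar> < \<delta> \<Longrightarrow> \<bar>(f (x + h) - f x) / h - deriv f x\<bar> < \<epsilon>" by auto
  have "\<bar>f y - (f x + deriv f x * (y - x))\<bar> \<le> \<epsilon> * \<bar>y - x\<bar>" if "\<bar>y - x\<bar> < \<delta>" for y
  proof (cases "y = x")
    case False
    have "f y - (f x + deriv f x * (y - x)) = ((f y - f x) / (y - x) - deriv f x) * (y - x)"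
      using False by (simp add: field_simps)
    moreover have "\<bar>(f y - f x) / (y - x) - deriv f x\<bar> \<le> \<epsilon>"
      using \<delta>(2)[of "y - x"] that False by simp
    ultimately show ?thesis by (simp add: abs_mult mult_right_mono)
  qed simp
  thus ?case using \<delta>(1) by (intro exI[of _ \<delta>]) simp
next
  case (Suc n)
  define P where "P y = (\<Sum>j\<le>Suc (Suc n). (deriv ^^ j) f x / fact j * (y - x) ^ j)" for y
  define Q where "Q y = (\<Sum>j\<le>Suc n. (deriv ^^ j) (deriv f) x / fact j * (y - x) ^ j)" for y
  obtain \<delta>1 where \<delta>1: "\<delta>1 > 0" "\<And>y. \<bar>y - x\<bar> < \<delta>1 \<Longrightarrow> \<bar>deriv f y - Q y\<bar> \<le> \<epsilon> * \<bar>y - x\<bar> ^ Suc n"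
    using Suc.IH[OF nth_deriv_exists_deriv[OF Suc.prems(1)] Suc.prems(2)] unfolding Q_def by blast
  have "\<forall>\<^sub>F y in nhds x. f differentiable (at y)"
    using Suc.prems(1) unfolding nth_deriv_exists.simps(2)[of "Suc n"]
    by (blast intro: eventually_mono nth_deriv_exists_imp_differentiable)
  then obtain \<delta>2 where \<delta>2: "\<delta>2 > 0" "\<And>y. \<bar>y - x\<bar> < \<delta>2 \<Longrightarrow> f differentiable (at y)"
    by (auto simp: eventually_nhds_metric dist_real_def)
  have Px: "P x = f x" by (simp add: P_def sum.atMost_Suc_shift)
  have dP: "(P has_real_derivative Q y) (at y)" for y
  proof -
    have "(P has_real_derivative (\<Sum>j\<le>Suc (Suc n). (deriv ^^ j) f x / fact j * (of_nat j * (y - x) ^ (j - 1)))) (at y)"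
      unfolding P_def
    proof (rule DERIV_sum, rule DERIV_cmult)
      show "((\<lambda>y. (y - x) ^ j) has_real_derivative real j * (y - x) ^ (j - 1)) (at y)" for j
        by (auto intro!: derivative_eq_intros)
    qed
    moreover have "(\<Sum>j\<le>Suc (Suc n). (deriv ^^ j) f x / fact j * (of_nat j * (y - x) ^ (j - 1))) = Q y"
    proof -
      have "(deriv ^^ Suc j) f x / fact (Suc j) * (of_nat (Suc j) * (y - x) ^ (Suc j - 1))
          = (deriv ^^ j) (deriv f) x / fact j * (y - x) ^ j" for j
        by (simp add: funpow_swap1 divide_simps del: of_nat_Suc)
      thus ?thesis unfolding Q_def by (subst sum.atMost_Suc_shift) (simp only: of_nat_0 mult_zero_left mult_zero_right add_0)
    qed
    ultimately show ?thesis by simp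
  qed
  show ?case
  proof (intro exI[of _ "min \<delta>1 \<delta>2"] conjI allI impI)
    fix y assume y: "\<bar>y - x\<bar> < min \<delta>1 \<delta>2"
    define S where "S = cball x \<bar>y - x\<bar>"
    have S: "\<bar>z - x\<bar> \<le> \<bar>y - x\<bar>" if "z \<in> S" for z using that by (simp add: S_def dist_real_def abs_minus_commute)
    have "norm ((f y - P y) - (f x - P x)) \<le> (\<epsilon> * \<bar>y - x\<bar> ^ Suc n) * norm (y - x)"
    proof (rule field_differentiable_bound[of S])
      fix z assume z: "z \<in> S"
      show "((\<lambda>y. f y - P y) has_real_derivative (deriv f z - Q z)) (at z within S)"
      proof -
        have "(f has_real_derivative deriv f z) (at z)"
          using \<delta>2(2)[of z] S[OF z] y by (simp add: DERIV_deriv_iff_real_differentiable)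
        thus ?thesis by (rule has_field_derivative_at_within[OF DERIV_diff[OF _ dP]])
      qed
      have "\<bar>deriv f z - Q z\<bar> \<le> \<epsilon> * \<bar>z - x\<bar> ^ Suc n" using \<delta>1(2)[of z] S[OF z] y by simp
      also have "\<dots> \<le> \<epsilon> * \<bar>y - x\<bar> ^ Suc n" using S[OF z] Suc.prems(2) by (intro mult_left_mono power_mono) auto
      finally show "norm (deriv f z - Q z) \<le> \<epsilon> * \<bar>y - x\<bar> ^ Suc n" by simp
    qed (auto simp: S_def dist_real_def abs_minus_commute)
    hence "\<bar>f y - P y\<bar> \<le> \<epsilon> * \<bar>y - x\<bar> ^ Suc (Suc n)"
      by (simp add: Px mult_ac)
    thus "\<bar>f y - (\<Sum>j\<le>Suc (Suc n). (deriv ^^ j) f x / fact j * (y - x) ^ j)\<bar> \<le> \<epsilon> * \<bar>y - x\<bar> ^ Suc (Suc n)"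
      unfolding P_def .
  qed (use \<delta>1 \<delta>2 in auto)
qed

lemma has_real_derivative_of_complex:
  fixes g :: "real \<Rightarrow> real" and F :: "complex \<Rightarrow> complex"
  assumes F: "(F has_field_derivative D) (at (of_real y))"
    and g: "\<forall>\<^sub>F t in nhds y. F (of_real t) = of_real (g t)"
  shows "(g has_real_derivative Re D) (at y)" and "D = of_real (Re D)"
proof -
  have "filterlim complex_of_real (at (of_real y)) (at y)"
    by (auto simp: filterlim_at eventually_at_filter intro!: tendsto_intros)
  from filterlim_compose[OF F[unfolded has_field_derivative_iff] this]
  have "((\<lambda>t. (F (of_real t) - F (of_real y)) / (of_real t - of_real y)) \<longlongrightarrow> D) (at y)" .
  moreover have "\<forall>\<^sub>F t in at y. (F (of_real t) - F (of_real y)) / (of_real t - of_real y) = of_real ((g t - g y) / (t - y))"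
    using g unfolding eventually_nhds_conv_at by (auto elim: eventually_mono)
  ultimately have lim: "((\<lambda>t. complex_of_real ((g t - g y) / (t - y))) \<longlongrightarrow> D) (at y)"
    by (rule Lim_transform_eventually)
  from tendsto_Re[OF lim] show "(g has_real_derivative Re D) (at y)"
    by (simp add: has_field_derivative_iff)
  have "((\<lambda>t. 0) \<longlongrightarrow> Im D) (at y)" using tendsto_Im[OF lim] by simp
  hence "Im D = 0" using tendsto_unique[OF trivial_limit_at] tendsto_const by blast
  thus "D = of_real (Re D)" by (simp add: complex_eq_iff)
qed

lemma nth_deriv_holomorphic_extension:
  fixes g :: "real \<Rightarrow> real" and F :: "complex \<Rightarrow> complex"
  assumes S: "open S" and F: "F holomorphic_on S"
    and g: "\<And>y. of_real y \<in> S \<Longrightarrow> F (of_real y) = of_real (g y)"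
    and y: "of_real y \<in> S"
  shows "nth_deriv_exists n g y \<and> (deriv ^^ n) F (of_real y) = of_real ((deriv ^^ n) g y)"
  using y
proof (induction n arbitrary: y)
  case 0
  thus ?case using g by simp
next
  case (Suc n)
  have "open (complex_of_real -` S)" by (intro open_vimage S continuous_intros)
  hence ev: "\<forall>\<^sub>F t in nhds y. of_real t \<in> S"
    using Suc.prems by (auto simp: eventually_nhds)
  have "((deriv ^^ n) F has_field_derivative deriv ((deriv ^^ n) F) (of_real y)) (at (of_real y))"
    using F S Suc.prems by (intro holomorphic_derivI[of _ S] holomorphic_higher_deriv)
  from has_real_derivative_of_complex[OF this eventually_mono[OF ev]] Suc.IH
  have d: "((deriv ^^ n) g has_real_derivative Re (deriv ((deriv ^^ n) F) (of_real y))) (at y)"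
    "deriv ((deriv ^^ n) F) (of_real y) = of_real (Re (deriv ((deriv ^^ n) F) (of_real y)))" by blast+
  from DERIV_imp_deriv[OF d(1)] d(2) have "(deriv ^^ Suc n) F (of_real y) = of_real ((deriv ^^ Suc n) g y)"
    by simp
  moreover have "(deriv ^^ n) g differentiable (at y)"
    using d(1) real_differentiable_def by blast
  moreover have "\<forall>\<^sub>F t in nhds y. nth_deriv_exists n g t"
    using ev Suc.IH by (auto elim: eventually_mono)
  ultimately show ?case by simp
qed

subsection \<open>The complexified operator\<close>

text \<open>The image of \<open>(\<nu> - x)\<^sup>j\<close> as a polynomial in \<open>z = y - x\<close>, with \<open>c = 1/\<lambda>\<close>; note that
  \<open>a\<^sup>2 + y\<^sup>2 = (a\<^sup>2 + x\<^sup>2) + 2 x z + z\<^sup>2\<close>.\<close>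

definition monomial_image :: "real \<Rightarrow> real \<Rightarrow> real \<Rightarrow> nat \<Rightarrow> real poly" where
  "monomial_image a x c j =
     ((\<lambda>q. pCons 0 q + smult c ([:a\<^sup>2 + x\<^sup>2, 2 * x, 1:] * pderiv q)) ^^ j) 1"

lemma monomial_image_0: "monomial_image a x c 0 = 1"
  and monomial_image_Suc: "monomial_image a x c (Suc j) = pCons 0 (monomial_image a x c j)
       + smult c ([:a\<^sup>2 + x\<^sup>2, 2 * x, 1:] * pderiv (monomial_image a x c j))"
  by (simp_all only: monomial_image_def funpow.simps id_apply o_apply)

lemma DERIV_kappa:
  assumes "a > 0"
  shows "((\<lambda>y. kappa l a y \<nu>) has_real_derivative l * (\<nu> - y) / (a\<^sup>2 + y\<^sup>2) * kappa l a y \<nu>) (at y)"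
proof -
  have pos: "a\<^sup>2 + y\<^sup>2 > 0" for y using square_add_pos[OF assms] .
  define E where "E y = l * \<nu> / a * arctan (y / a) - l / 2 * ln (a\<^sup>2 + y\<^sup>2)" for y
  define K where "K = (2 powr (l - 2) * l) / (pi * Gamma l) * a powr (l - 1)
     * (cmod (Gamma ((complex_of_real (l * a) + \<i> * complex_of_real (l * \<nu>)) / complex_of_real (2 * a))))\<^sup>2"
  have eq: "kappa l a y \<nu> = K * exp (E y)" for y
  proof -
    have "a\<^sup>2 + y\<^sup>2 \<noteq> 0" using pos[of y] by linarith
    thus ?thesis by (simp add: kappa_def powr_def E_def K_def exp_diff)
  qed
  have "(E has_real_derivative l * \<nu> / a * (inverse (1 + (y / a)\<^sup>2) * (1 / a)) - l / 2 * (inverse (a\<^sup>2 + y\<^sup>2) * (2 * y))) (at y)"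
    unfolding E_def
  proof (rule DERIV_diff[OF DERIV_cmult DERIV_cmult])
    show "((\<lambda>y. arctan (y / a)) has_real_derivative inverse (1 + (y / a)\<^sup>2) * (1 / a)) (at y)"
      by (rule DERIV_chain2[OF DERIV_arctan]) (use assms in \<open>auto intro!: derivative_eq_intros\<close>)
    show "((\<lambda>y. ln (a\<^sup>2 + y\<^sup>2)) has_real_derivative inverse (a\<^sup>2 + y\<^sup>2) * (2 * y)) (at y)"
      by (rule DERIV_chain2[where f = ln and g = "\<lambda>y. a\<^sup>2 + y\<^sup>2"])
        (rule DERIV_ln[OF pos], auto intro!: derivative_eq_intros)
  qed
  also have "l * \<nu> / a * (inverse (1 + (y / a)\<^sup>2) * (1 / a)) - l / 2 * (inverse (a\<^sup>2 + y\<^sup>2) * (2 * y)) = l * (\<nu> - y) / (a\<^sup>2 + y\<^sup>2)"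
  proof -
    have "1 + (y / a)\<^sup>2 = (a\<^sup>2 + y\<^sup>2) / a\<^sup>2" using assms by (simp add: field_simps)
    hence "inverse (1 + (y / a)\<^sup>2) * (1 / a) = a / (a\<^sup>2 + y\<^sup>2)" using assms by (simp add: power2_eq_square)
    moreover have "l * \<nu> / a * (a / q) = l * \<nu> / q" "l / 2 * (inverse q * (2 * y)) = l * y / q" for q
      using assms by (simp_all add: inverse_eq_divide)
    ultimately show ?thesis by (simp only: right_diff_distrib diff_divide_distrib)
  qed
  finally have "((\<lambda>y. K * exp (E y)) has_real_derivative K * (exp (E y) * (l * (\<nu> - y) / (a\<^sup>2 + y\<^sup>2)))) (at y)"
    by (rule DERIV_cmult[OF DERIV_chain2[OF DERIV_exp]])
  thus ?thesis unfolding eq by (simp only: mult_ac)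
qed

locale kappa_moment =
  fixes a x l N B :: real
  assumes a: "a > 0" and N: "N \<ge> 1" and l: "l \<ge> 1" and ball_small: "2 / sqrt l \<le> a / 2"
    and moment: "integrable lborel (\<lambda>\<nu>. kappa l a x \<nu> * exp ((N + 4 / a\<^sup>2) * (sqrt l * \<bar>\<nu> - x\<bar>)))"
    and moment_le: "(\<integral>\<nu>. kappa l a x \<nu> * exp ((N + 4 / a\<^sup>2) * (sqrt l * \<bar>\<nu> - x\<bar>)) \<partial>lborel) \<le> B"
begin

definition dev :: "real \<Rightarrow> real" where "dev \<nu> = sqrt l * \<bar>\<nu> - x\<bar>"

lemma l_pos: "l > 0" using l by simp

lemma dev_nonneg: "dev \<nu> \<ge> 0" using l by (simp add: dev_def)

lemma abs_le_dev: "\<bar>\<nu> - x\<bar> \<le> dev \<nu>"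
proof -
  have "1 * \<bar>\<nu> - x\<bar> \<le> sqrt l * \<bar>\<nu> - x\<bar>" using l by (intro mult_right_mono) auto
  thus ?thesis by (simp add: dev_def)
qed

lemma kappa_measurable [measurable]: "kappa l a y \<in> borel_measurable borel"
  using borel_measurable_has_bochner_integral[OF has_bochner_integral_kappa[OF l_pos a, of y]] by simp

lemma kappa_mult_bound:
  fixes h :: "real \<Rightarrow> 'b::{real_normed_field,banach,second_countable_topology}"
  assumes h: "h \<in> borel_measurable borel" and le: "\<And>\<nu>. norm (h \<nu>) \<le> C * exp ((N + 4 / a\<^sup>2) * dev \<nu>)"
  shows "integrable lborel (\<lambda>\<nu>. of_real (kappa l a x \<nu>) * h \<nu>)"
    and "norm (\<integral>\<nu>. of_real (kappa l a x \<nu>) * h \<nu> \<partial>lborel) \<le> C * B"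
proof -
  let ?g = "\<lambda>\<nu>. C * (kappa l a x \<nu> * exp ((N + 4 / a\<^sup>2) * (sqrt l * \<bar>\<nu> - x\<bar>)))"
  have C: "C \<ge> 0"
  proof -
    have "0 \<le> C * exp ((N + 4 / a\<^sup>2) * dev x)" using order_trans[OF norm_ge_zero le] .
    thus ?thesis by (simp add: zero_le_mult_iff)
  qed
  have g: "integrable lborel ?g" by (intro integrable_mult_right moment)
  have bound: "norm (of_real (kappa l a x \<nu>) * h \<nu>) \<le> ?g \<nu>" for \<nu>
    using mult_left_mono[OF le[of \<nu>] kappa_nonneg[OF l_pos a, of x \<nu>]] kappa_nonneg[OF l_pos a, of x \<nu>]
    by (simp add: norm_mult dev_def mult_ac)
  show int: "integrable lborel (\<lambda>\<nu>. of_real (kappa l a x \<nu>) * h \<nu>)"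
  proof (rule Bochner_Integration.integrable_bound[OF g])
    show "(\<lambda>\<nu>. of_real (kappa l a x \<nu>) * h \<nu>) \<in> borel_measurable lborel" using h by measurable
    show "AE \<nu> in lborel. norm (of_real (kappa l a x \<nu>) * h \<nu>) \<le> norm (?g \<nu>)"
      unfolding real_norm_def by (intro AE_I2 order_trans[OF bound abs_ge_self])
  qed
  have "norm (\<integral>\<nu>. of_real (kappa l a x \<nu>) * h \<nu> \<partial>lborel) \<le> integral\<^sup>L lborel ?g"
    by (rule Bochner_Integration.integral_norm_bound_integral[OF int g]) (rule bound)
  also have "\<dots> \<le> C * B" using C moment_le by (simp add: mult_left_mono)
  finally show "norm (\<integral>\<nu>. of_real (kappa l a x \<nu>) * h \<nu> \<partial>lborel) \<le> C * B" .
qed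

lemma kernel_ratio_bound:
  assumes "w \<in> cball (of_real x) (2 / sqrt l)"
  shows "norm (kernel_ratio l a x w \<nu>) \<le> exp (8 / a\<^sup>2) * exp (4 / a\<^sup>2 * dev \<nu>)"
proof -
  have "2 / a\<^sup>2 * 2\<^sup>2 = 8 / a\<^sup>2" "2 / a\<^sup>2 * 2 = 4 / a\<^sup>2" by simp_all
  thus ?thesis using norm_kernel_ratio_le[OF a l_pos zero_le_numeral ball_small assms, of \<nu>]
    by (simp only: dev_def)
qed

lemma kernel_ratio_mult_bound:
  assumes w: "w \<in> cball (of_real x) (2 / sqrt l)" and h: "norm (h :: complex) \<le> C * exp (N * dev \<nu>)"
  shows "norm (kernel_ratio l a x w \<nu> * h) \<le> exp (8 / a\<^sup>2) * C * exp ((N + 4 / a\<^sup>2) * dev \<nu>)"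
proof -
  have "norm (kernel_ratio l a x w \<nu>) * norm h \<le> (exp (8 / a\<^sup>2) * exp (4 / a\<^sup>2 * dev \<nu>)) * (C * exp (N * dev \<nu>))"
    using kernel_ratio_bound[OF w] h by (intro mult_mono) auto
  also have "\<dots> = exp (8 / a\<^sup>2) * C * (exp (N * dev \<nu>) * exp (4 / a\<^sup>2 * dev \<nu>))" by simp
  finally show ?thesis by (simp only: norm_mult distrib_right exp_add)
qed

lemma kernel_ratio_measurable [measurable]: "kernel_ratio l a x w \<in> borel_measurable borel"
  unfolding kernel_ratio_def[abs_def] by measurable

definition T_complex :: "(real \<Rightarrow> real) \<Rightarrow> complex \<Rightarrow> complex" where
  "T_complex f w = (\<integral>\<nu>. of_real (kappa l a x \<nu>) * (kernel_ratio l a x w \<nu> * of_real (f \<nu>)) \<partial>lborel)"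

lemma T_complex_bound:
  assumes f: "f \<in> borel_measurable borel" "\<And>\<nu>. \<bar>f \<nu>\<bar> \<le> C * exp (N * dev \<nu>)"
    and w: "w \<in> cball (of_real x) (2 / sqrt l)"
  shows "integrable lborel (\<lambda>\<nu>. of_real (kappa l a x \<nu>) * (kernel_ratio l a x w \<nu> * of_real (f \<nu>)))"
    and "norm (T_complex f w) \<le> exp (8 / a\<^sup>2) * C * B"
proof -
  have m: "(\<lambda>\<nu>. kernel_ratio l a x w \<nu> * of_real (f \<nu>)) \<in> borel_measurable borel" using f(1) by measurable
  have b: "norm (kernel_ratio l a x w \<nu> * of_real (f \<nu>)) \<le> exp (8 / a\<^sup>2) * C * exp ((N + 4 / a\<^sup>2) * dev \<nu>)" for \<nu>
    using f(2) by (intro kernel_ratio_mult_bound[OF w]) simp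
  show "integrable lborel (\<lambda>\<nu>. of_real (kappa l a x \<nu>) * (kernel_ratio l a x w \<nu> * of_real (f \<nu>)))"
    by (rule kappa_mult_bound(1)[OF m b])
  show "norm (T_complex f w) \<le> exp (8 / a\<^sup>2) * C * B"
    unfolding T_complex_def by (rule kappa_mult_bound(2)[OF m b])
qed

lemma T_complex_holomorphic:
  assumes f: "f \<in> borel_measurable borel" "\<And>\<nu>. \<bar>f \<nu>\<bar> \<le> C * exp (N * dev \<nu>)"
  shows "T_complex f holomorphic_on ball (of_real x) (2 / sqrt l)"
  unfolding T_complex_def[abs_def]
proof (rule holomorphic_on_lebesgue_integral)
  let ?S = "ball (complex_of_real x) (2 / sqrt l)"
  show "open ?S" by simp
  show "(\<lambda>\<nu>. complex_of_real (kappa l a x \<nu>) * (kernel_ratio l a x w \<nu> * complex_of_real (f \<nu>))) \<in> borel_measurable lborel" for w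
    using f(1) by measurable
  show "(\<lambda>w. complex_of_real (kappa l a x \<nu>) * (kernel_ratio l a x w \<nu> * complex_of_real (f \<nu>))) holomorphic_on ?S" for \<nu>
  proof -
    have Im: "\<bar>Im w\<bar> < a" if "w \<in> ?S" for w
    proof -
      have "\<bar>Im w\<bar> \<le> norm (w - of_real x)" using abs_Im_le_cmod[of "w - of_real x"] by simp
      also have "\<dots> < 2 / sqrt l" using that by (simp add: dist_norm norm_minus_commute)
      also have "\<dots> < a" using ball_small a by linarith
      finally show ?thesis .
    qed
    have "kernel_angle a holomorphic_on ?S" "kernel_potential a x holomorphic_on ?S"
      unfolding holomorphic_on_open[OF open_ball]
      using DERIV_kernel_angle[OF a Im] DERIV_kernel_potential[OF a Im] by blast+
    thus ?thesis unfolding kernel_ratio_def by (intro holomorphic_intros)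
  qed
  show "\<exists>r>0. \<exists>g. integrable lborel g \<and> (\<forall>z\<in>cball w r \<inter> ?S. \<forall>\<nu>. norm (complex_of_real (kappa l a x \<nu>) * (kernel_ratio l a x z \<nu> * complex_of_real (f \<nu>))) \<le> g \<nu>)" for w
  proof (intro exI[of _ 1] conjI exI[of _ "\<lambda>\<nu>. exp (8 / a\<^sup>2) * C * (kappa l a x \<nu> * exp ((N + 4 / a\<^sup>2) * (sqrt l * \<bar>\<nu> - x\<bar>)))"] ballI allI)
    fix z \<nu> assume "z \<in> cball w 1 \<inter> ?S"
    hence "norm (kernel_ratio l a x z \<nu> * complex_of_real (f \<nu>)) \<le> exp (8 / a\<^sup>2) * C * exp ((N + 4 / a\<^sup>2) * dev \<nu>)"
      using f(2) by (intro kernel_ratio_mult_bound) auto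
    from mult_left_mono[OF this kappa_nonneg[OF l_pos a, of x \<nu>]]
    show "norm (complex_of_real (kappa l a x \<nu>) * (kernel_ratio l a x z \<nu> * complex_of_real (f \<nu>)))
        \<le> exp (8 / a\<^sup>2) * C * (kappa l a x \<nu> * exp ((N + 4 / a\<^sup>2) * (sqrt l * \<bar>\<nu> - x\<bar>)))"
      unfolding norm_mult[of "complex_of_real (kappa l a x \<nu>)"] norm_of_real
      using kappa_nonneg[OF l_pos a, of x \<nu>] by (simp only: abs_of_nonneg dev_def mult_ac)
  qed (simp, intro integrable_mult_right moment)
qed

lemma T_complex_of_real:
  assumes f: "f \<in> borel_measurable borel" "\<And>\<nu>. \<bar>f \<nu>\<bar> \<le> C * exp (N * dev \<nu>)"
    and y: "\<bar>y - x\<bar> \<le> 2 / sqrt l"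
  shows "T_integrable l a f y" and "T_complex f (of_real y) = of_real (T_op l a f y)"
proof -
  have w: "complex_of_real y \<in> cball (of_real x) (2 / sqrt l)"
    using y by (simp add: dist_norm norm_minus_commute flip: of_real_diff)
  have eq: "of_real (kappa l a x \<nu>) * (kernel_ratio l a x (of_real y) \<nu> * of_real (f \<nu>)) = complex_of_real (kappa l a y \<nu> * f \<nu>)" for \<nu>
    using kappa_eq_kernel_ratio[OF a, of l y \<nu> x] by (simp only: of_real_mult mult.assoc)
  show "T_integrable l a f y"
    using T_complex_bound(1)[OF f w] unfolding T_integrable_def eq complex_of_real_integrable_eq .
  show "T_complex f (of_real y) = of_real (T_op l a f y)"
    unfolding T_complex_def eq T_op_def by (rule integral_complex_of_real)
qed

lemma abs_power_le_exp_dev: "\<bar>(\<nu> - x) ^ j\<bar> \<le> fact j * exp (N * dev \<nu>)"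
proof -
  have "\<bar>(\<nu> - x) ^ j\<bar> \<le> dev \<nu> ^ j" unfolding power_abs by (intro power_mono abs_le_dev) auto
  also have "\<dots> \<le> fact j * exp (dev \<nu>)" by (rule power_le_fact_exp[OF dev_nonneg])
  also have "\<dots> \<le> fact j * exp (N * dev \<nu>)"
    using mult_right_mono[OF N dev_nonneg[of \<nu>]] by (intro mult_left_mono) auto
  finally show ?thesis .
qed

lemma T_op_monomial_step:
  assumes N2: "N \<ge> 2" and y: "\<bar>y - x\<bar> < 2 / sqrt l"
  shows "((\<lambda>y. T_op l a (\<lambda>\<nu>. (\<nu> - x) ^ j) y) has_real_derivative
            l / (a\<^sup>2 + y\<^sup>2) * (T_op l a (\<lambda>\<nu>. (\<nu> - x) ^ Suc j) y - (y - x) * T_op l a (\<lambda>\<nu>. (\<nu> - x) ^ j) y)) (at y)"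
proof -
  let ?S = "ball x (2 / sqrt l)"
  have int: "integrable lborel (\<lambda>\<nu>. kappa l a z \<nu> * (\<nu> - x) ^ j)" if "z \<in> ?S" for z j
    using T_complex_of_real(1)[OF _ abs_power_le_exp_dev] that
    by (simp add: T_integrable_def dist_real_def abs_minus_commute)
  define M where "M = l * (2 / sqrt l + 1) / a\<^sup>2 * fact j"
  have M: "M \<ge> 0" using l by (simp add: M_def)
  have "((\<lambda>y. \<integral>\<nu>. kappa l a y \<nu> * (\<nu> - x) ^ j \<partial>lborel) has_real_derivative
          (\<integral>\<nu>. l * (\<nu> - y) / (a\<^sup>2 + y\<^sup>2) * kappa l a y \<nu> * (\<nu> - x) ^ j \<partial>lborel)) (at y)"
  proof (rule has_field_derivative_lebesgue_integral[where S = ?S and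
        g = "\<lambda>\<nu>. (exp (8 / a\<^sup>2) * M) * (kappa l a x \<nu> * exp ((N + 4 / a\<^sup>2) * (sqrt l * \<bar>\<nu> - x\<bar>)))"])
    fix z \<nu> assume z: "z \<in> ?S"
    show "((\<lambda>z. kappa l a z \<nu> * (\<nu> - x) ^ j) has_real_derivative l * (\<nu> - z) / (a\<^sup>2 + z\<^sup>2) * kappa l a z \<nu> * (\<nu> - x) ^ j) (at z)"
      by (rule DERIV_cmult_right[OF DERIV_kappa[OF a]])
    have zx: "\<bar>z - x\<bar> < 2 / sqrt l" using z by (simp add: dist_real_def abs_minus_commute)
    have q: "a\<^sup>2 + z\<^sup>2 > 0" using square_add_pos[OF a] .
    have "\<bar>l * (\<nu> - z) / (a\<^sup>2 + z\<^sup>2)\<bar> \<le> l * (2 / sqrt l + 1) / a\<^sup>2 * exp (dev \<nu>)"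
    proof -
      have "\<bar>\<nu> - z\<bar> \<le> 2 / sqrt l + dev \<nu>" using zx abs_le_dev[of \<nu>] by linarith
      also have "\<dots> \<le> 2 / sqrt l * exp (dev \<nu>) + exp (dev \<nu>)"
      proof (rule add_mono)
        have "2 / sqrt l * 1 \<le> 2 / sqrt l * exp (dev \<nu>)" using l dev_nonneg by (intro mult_left_mono) auto
        thus "2 / sqrt l \<le> 2 / sqrt l * exp (dev \<nu>)" by simp
        show "dev \<nu> \<le> exp (dev \<nu>)" using exp_ge_add_one_self[of "dev \<nu>"] by linarith
      qed
      finally have 1: "\<bar>\<nu> - z\<bar> \<le> (2 / sqrt l + 1) * exp (dev \<nu>)" by (simp add: algebra_simps)
      have "\<bar>l * (\<nu> - z) / (a\<^sup>2 + z\<^sup>2)\<bar> = l * \<bar>\<nu> - z\<bar> / (a\<^sup>2 + z\<^sup>2)" using l q by (simp add: abs_mult)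
      also have "\<dots> \<le> l * ((2 / sqrt l + 1) * exp (dev \<nu>)) / a\<^sup>2"
        using l a 1 by (intro frac_le mult_left_mono mult_nonneg_nonneg) auto
      finally show ?thesis by simp
    qed
    moreover have "\<bar>(\<nu> - x) ^ j\<bar> \<le> fact j * exp (dev \<nu>)"
      unfolding power_abs by (rule order_trans[OF power_mono[OF abs_le_dev] power_le_fact_exp[OF dev_nonneg]]) simp
    ultimately have "\<bar>l * (\<nu> - z) / (a\<^sup>2 + z\<^sup>2)\<bar> * \<bar>(\<nu> - x) ^ j\<bar> \<le> (l * (2 / sqrt l + 1) / a\<^sup>2 * exp (dev \<nu>)) * (fact j * exp (dev \<nu>))"
      by (intro mult_mono') auto
    also have "\<dots> = M * exp (2 * dev \<nu>)" by (simp add: M_def exp_double power2_eq_square)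
    also have "\<dots> \<le> M * exp (N * dev \<nu>)"
      using M mult_right_mono[OF N2 dev_nonneg[of \<nu>]] by (intro mult_left_mono) auto
    finally have "norm (complex_of_real (l * (\<nu> - z) / (a\<^sup>2 + z\<^sup>2) * (\<nu> - x) ^ j)) \<le> M * exp (N * dev \<nu>)"
      by (simp only: norm_of_real abs_mult)
    moreover have "complex_of_real z \<in> cball (of_real x) (2 / sqrt l)"
      using zx by (simp add: dist_norm norm_minus_commute flip: of_real_diff)
    ultimately have "norm (kernel_ratio l a x (of_real z) \<nu> * complex_of_real (l * (\<nu> - z) / (a\<^sup>2 + z\<^sup>2) * (\<nu> - x) ^ j))
        \<le> exp (8 / a\<^sup>2) * M * exp ((N + 4 / a\<^sup>2) * dev \<nu>)"
      by (intro kernel_ratio_mult_bound)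
    from mult_left_mono[OF this kappa_nonneg[OF l_pos a, of x \<nu>]]
    have "norm (complex_of_real (kappa l a z \<nu>) * complex_of_real (l * (\<nu> - z) / (a\<^sup>2 + z\<^sup>2) * (\<nu> - x) ^ j))
        \<le> kappa l a x \<nu> * (exp (8 / a\<^sup>2) * M * exp ((N + 4 / a\<^sup>2) * dev \<nu>))"
      unfolding kappa_eq_kernel_ratio[OF a, of l z \<nu> x] mult.assoc[of "complex_of_real (kappa l a x \<nu>)"]
        norm_mult[of "complex_of_real (kappa l a x \<nu>)"] norm_of_real
      using kappa_nonneg[OF l_pos a, of x \<nu>] by (simp only: abs_of_nonneg)
    thus "norm (l * (\<nu> - z) / (a\<^sup>2 + z\<^sup>2) * kappa l a z \<nu> * (\<nu> - x) ^ j)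
        \<le> (exp (8 / a\<^sup>2) * M) * (kappa l a x \<nu> * exp ((N + 4 / a\<^sup>2) * (sqrt l * \<bar>\<nu> - x\<bar>)))"
      by (simp only: of_real_mult[symmetric] norm_of_real real_norm_def dev_def mult_ac)
  next
    show "y \<in> ?S" using y by (simp add: dist_real_def abs_minus_commute)
  qed (use int moment in auto)
  moreover have "(\<integral>\<nu>. l * (\<nu> - y) / (a\<^sup>2 + y\<^sup>2) * kappa l a y \<nu> * (\<nu> - x) ^ j \<partial>lborel)
      = l / (a\<^sup>2 + y\<^sup>2) * (T_op l a (\<lambda>\<nu>. (\<nu> - x) ^ Suc j) y - (y - x) * T_op l a (\<lambda>\<nu>. (\<nu> - x) ^ j) y)"
  proof -
    have yS: "y \<in> ?S" using y by (simp add: dist_real_def abs_minus_commute)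
    have eq: "l * (\<nu> - y) / (a\<^sup>2 + y\<^sup>2) * kappa l a y \<nu> * (\<nu> - x) ^ j
        = l / (a\<^sup>2 + y\<^sup>2) * (kappa l a y \<nu> * (\<nu> - x) ^ Suc j - (y - x) * (kappa l a y \<nu> * (\<nu> - x) ^ j))" for \<nu>
    proof -
      have "l * (\<nu> - y) / q * k * (\<nu> - x) ^ j = l / q * (k * (\<nu> - x) ^ Suc j - (y - x) * (k * (\<nu> - x) ^ j))" for q k
        by (simp add: algebra_simps divide_inverse)
      thus ?thesis .
    qed
    show ?thesis unfolding T_op_def eq using int[OF yS, of j] int[OF yS, of "Suc j"]
      by (simp del: power_Suc)
  qed
  ultimately show ?thesis by (simp only: T_op_def)
qed

lemma T_op_monomial:
  assumes N2: "N \<ge> 2" and y: "\<bar>y - x\<bar> < 2 / sqrt l"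
  shows "T_op l a (\<lambda>\<nu>. (\<nu> - x) ^ j) y = poly (monomial_image a x (1 / l) j) (y - x)"
  using y
proof (induction j arbitrary: y)
  case 0
  show ?case using has_bochner_integral_kappa[OF l_pos a, of y]
    by (simp add: T_op_def monomial_image_0 has_bochner_integral_iff)
next
  case (Suc j)
  let ?p = "monomial_image a x (1 / l) j"
  have q: "a\<^sup>2 + y\<^sup>2 \<noteq> 0" using square_add_pos[OF a, of y] by linarith
  have "((\<lambda>y. poly ?p (y - x)) has_real_derivative poly (pderiv ?p) (y - x)) (at y)"
    by (auto intro!: derivative_eq_intros poly_DERIV)
  moreover have "\<forall>\<^sub>F z in nhds y. T_op l a (\<lambda>\<nu>. (\<nu> - x) ^ j) z = poly ?p (z - x)"
  proof -
    have "open (ball x (2 / sqrt l))" "y \<in> ball x (2 / sqrt l)"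
      using Suc.prems by (auto simp: dist_real_def abs_minus_commute)
    hence "\<forall>\<^sub>F z in nhds y. z \<in> ball x (2 / sqrt l)" by (rule eventually_nhds_in_open)
    thus ?thesis by (rule eventually_mono) (use Suc.IH in \<open>auto simp: dist_real_def abs_minus_commute\<close>)
  qed
  ultimately have "((\<lambda>y. T_op l a (\<lambda>\<nu>. (\<nu> - x) ^ j) y) has_real_derivative poly (pderiv ?p) (y - x)) (at y)"
    by (subst DERIV_cong_ev[OF refl _ refl])
  from DERIV_unique[OF T_op_monomial_step[OF N2 Suc.prems] this]
  have "l / (a\<^sup>2 + y\<^sup>2) * (T_op l a (\<lambda>\<nu>. (\<nu> - x) ^ Suc j) y - (y - x) * poly ?p (y - x)) = poly (pderiv ?p) (y - x)"
    using Suc by simp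
  hence step: "T_op l a (\<lambda>\<nu>. (\<nu> - x) ^ Suc j) y
      = (y - x) * poly ?p (y - x) + 1 / l * ((a\<^sup>2 + y\<^sup>2) * poly (pderiv ?p) (y - x))"
    using q l by (simp add: field_simps)
  have quadratic: "poly [:a\<^sup>2 + x\<^sup>2, 2 * x, 1:] (y - x) = a\<^sup>2 + y\<^sup>2"
    by (simp add: power2_eq_square algebra_simps)
  have "poly (pCons 0 u + smult c (v * w)) z = z * poly u z + c * (poly v z * poly w z)"
    for u v w :: "real poly" and c z by simp
  thus ?case unfolding monomial_image_Suc step by (simp only: quadratic)
qed

end

subsection \<open>Asymptotic expansion\<close>

lemma eventually_kappa_moment:
  assumes a: "a > 0" and N: "N \<ge> 1"
  shows "\<exists>B. \<forall>\<^sub>F l in at_top. kappa_moment a x l N B"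
proof -
  have "N + 4 / a\<^sup>2 > 0" using a N by (intro add_pos_nonneg) auto
  from kappa_exponential_moment[OF a this, of x] obtain B where
    B: "\<forall>\<^sub>F l in at_top. integrable lborel (\<lambda>\<nu>. kappa l a x \<nu> * exp ((N + 4 / a\<^sup>2) * (sqrt l * \<bar>\<nu> - x\<bar>)))
       \<and> (\<integral>\<nu>. kappa l a x \<nu> * exp ((N + 4 / a\<^sup>2) * (sqrt l * \<bar>\<nu> - x\<bar>)) \<partial>lborel) \<le> B" by blast
  have "\<forall>\<^sub>F l in at_top. kappa_moment a x l N B"
    using B eventually_ge_at_top[of 1] eventually_ge_at_top[of "(4 / a)\<^sup>2"]
  proof eventually_elim
    case (elim l)
    have "4 / a \<le> sqrt l" using elim(3) by (rule real_le_rsqrt)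
    hence "2 / sqrt l \<le> a / 2" using a elim(2) by (simp add: field_simps)
    thus ?case using elim a N by unfold_locales auto
  qed
  thus ?thesis by blast
qed

lemma tendsto_sqrt_power_mult_exp:
  assumes "\<delta> > (0::real)"
  shows "((\<lambda>l. sqrt l ^ n * exp (- (\<delta> * sqrt l))) \<longlongrightarrow> 0) at_top"
proof -
  have "filterlim (\<lambda>l. \<delta> * sqrt l) at_top at_top"
    using assms by (intro filterlim_tendsto_pos_mult_at_top[OF tendsto_const] sqrt_at_top)
  from filterlim_compose[OF tendsto_power_div_exp_0[of n] this]
  have "((\<lambda>l. (\<delta> * sqrt l) ^ n / exp (\<delta> * sqrt l) / \<delta> ^ n) \<longlongrightarrow> 0 / \<delta> ^ n) at_top"
    using assms by (intro tendsto_intros) auto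
  thus ?thesis using assms by (simp add: power_mult_distrib exp_minus field_simps)
qed

lemma (in kappa_moment) higher_deriv_T_complex_le:
  assumes R: "R \<in> borel_measurable borel"
    and growth: "\<And>\<nu>. \<bar>R \<nu>\<bar> \<le> K * exp ((N - 1) * \<bar>\<nu> - x\<bar>)" and K: "K \<ge> 0"
    and small: "\<And>\<nu>. \<bar>\<nu> - x\<bar> < \<delta> \<Longrightarrow> \<bar>R \<nu>\<bar> \<le> \<epsilon> * \<bar>\<nu> - x\<bar> ^ (p + 2)" and \<epsilon>: "\<epsilon> \<ge> 0"
  shows "l * norm ((deriv ^^ p) (T_complex R) (of_real x))
           \<le> fact p * exp (8 / a\<^sup>2) * B * (\<epsilon> * fact (p + 2) + K * (sqrt l ^ (p + 2) * exp (- (\<delta> * sqrt l))))"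
proof -
  define A where "A = \<epsilon> * fact (p + 2) + K * (sqrt l ^ (p + 2) * exp (- (\<delta> * sqrt l)))"
  have sl: "sqrt l > 0" using l by simp
  have Ke: "K * (sqrt l ^ (p + 2) * exp (- (\<delta> * sqrt l))) \<ge> 0" using K sl by simp
  have A: "sqrt l ^ (p + 2) * \<bar>R \<nu>\<bar> \<le> A * exp (N * dev \<nu>)" for \<nu>
  proof (cases "\<bar>\<nu> - x\<bar> < \<delta>")
    case True
    have "sqrt l ^ (p + 2) * \<bar>R \<nu>\<bar> \<le> sqrt l ^ (p + 2) * (\<epsilon> * \<bar>\<nu> - x\<bar> ^ (p + 2))"
      using small[OF True] sl by (intro mult_left_mono) auto
    also have "\<dots> = \<epsilon> * dev \<nu> ^ (p + 2)" by (simp only: dev_def power_mult_distrib mult_ac)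
    also have "\<dots> \<le> \<epsilon> * (fact (p + 2) * exp (dev \<nu>))"
      by (intro mult_left_mono power_le_fact_exp dev_nonneg \<epsilon>)
    also have "\<dots> \<le> \<epsilon> * (fact (p + 2) * exp (N * dev \<nu>))"
      using mult_right_mono[OF N dev_nonneg[of \<nu>]] \<epsilon> by (intro mult_left_mono) auto
    also have "\<dots> = (\<epsilon> * fact (p + 2)) * exp (N * dev \<nu>)" by (simp only: mult.assoc)
    also have "\<dots> \<le> A * exp (N * dev \<nu>)"
      using Ke unfolding A_def by (intro mult_right_mono) auto
    finally show ?thesis .
  next
    case False
    have "\<delta> * sqrt l \<le> dev \<nu>" using False sl by (simp add: dev_def mult.commute)
    moreover have "(N - 1) * \<bar>\<nu> - x\<bar> \<le> (N - 1) * dev \<nu>" using N abs_le_dev by (intro mult_left_mono) auto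
    ultimately have "(N - 1) * \<bar>\<nu> - x\<bar> \<le> - (\<delta> * sqrt l) + N * dev \<nu>" by (simp add: algebra_simps)
    hence "exp ((N - 1) * \<bar>\<nu> - x\<bar>) \<le> exp (- (\<delta> * sqrt l)) * exp (N * dev \<nu>)"
      by (simp only: exp_add[symmetric] exp_le_cancel_iff)
    hence "\<bar>R \<nu>\<bar> \<le> K * (exp (- (\<delta> * sqrt l)) * exp (N * dev \<nu>))"
      using K by (intro order_trans[OF growth] mult_left_mono)
    hence "sqrt l ^ (p + 2) * \<bar>R \<nu>\<bar> \<le> sqrt l ^ (p + 2) * (K * (exp (- (\<delta> * sqrt l)) * exp (N * dev \<nu>)))"
      using sl by (intro mult_left_mono) auto
    also have "\<dots> = (K * (sqrt l ^ (p + 2) * exp (- (\<delta> * sqrt l)))) * exp (N * dev \<nu>)" by (simp only: mult_ac)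
    also have "\<dots> \<le> A * exp (N * dev \<nu>)"
      using \<epsilon> unfolding A_def by (intro mult_right_mono) auto
    finally show ?thesis .
  qed
  have R_le: "\<bar>R \<nu>\<bar> \<le> A / sqrt l ^ (p + 2) * exp (N * dev \<nu>)" for \<nu>
    using A[of \<nu>] sl by (simp add: field_simps del: power_add power_Suc)
  have sub: "cball (complex_of_real x) (1 / sqrt l) \<subseteq> ball (of_real x) (2 / sqrt l)"
    using sl by (simp add: cball_subset_ball_iff divide_strict_right_mono)
  have "norm ((deriv ^^ p) (T_complex R) (of_real x)) \<le> fact p * (exp (8 / a\<^sup>2) * (A / sqrt l ^ (p + 2)) * B) / (1 / sqrt l) ^ p"
  proof (rule Cauchy_inequality)
    show "T_complex R holomorphic_on ball (of_real x) (1 / sqrt l)"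
      using T_complex_holomorphic[OF R R_le] by (rule holomorphic_on_subset) (use sub ball_subset_cball in blast)
    show "continuous_on (cball (of_real x) (1 / sqrt l)) (T_complex R)"
      by (intro holomorphic_on_imp_continuous_on holomorphic_on_subset[OF T_complex_holomorphic[OF R R_le] sub])
    fix w assume "norm (complex_of_real x - w) = 1 / sqrt l"
    hence "w \<in> cball (complex_of_real x) (1 / sqrt l)" by (simp add: dist_norm)
    hence "w \<in> cball (complex_of_real x) (2 / sqrt l)" using sub ball_subset_cball by blast
    thus "norm (T_complex R w) \<le> exp (8 / a\<^sup>2) * (A / sqrt l ^ (p + 2)) * B" by (rule T_complex_bound(2)[OF R R_le])
  qed (use sl in simp)
  hence "l * norm ((deriv ^^ p) (T_complex R) (of_real x)) \<le> l * (fact p * (exp (8 / a\<^sup>2) * (A / sqrt l ^ (p + 2)) * B) / (1 / sqrt l) ^ p)"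
    using l by (intro mult_left_mono) auto
  also have "\<dots> = fact p * exp (8 / a\<^sup>2) * B * A * (l * sqrt l ^ p / sqrt l ^ (p + 2))"
    by (simp add: divide_inverse power_inverse)
  also have "l * sqrt l ^ p / sqrt l ^ (p + 2) = 1"
    using l sl by (simp add: power_add)
  finally show ?thesis by (simp add: A_def)
qed

lemma tendsto_higher_deriv_T_complex:
  assumes a: "a > 0" and N: "N \<ge> 1" and R: "R \<in> borel_measurable borel"
    and growth: "\<And>\<nu>. \<bar>R \<nu>\<bar> \<le> K * exp ((N - 1) * \<bar>\<nu> - x\<bar>)"
    and small: "\<And>\<epsilon>. \<epsilon> > 0 \<Longrightarrow> \<exists>\<delta>>0. \<forall>\<nu>. \<bar>\<nu> - x\<bar> < \<delta> \<longrightarrow> \<bar>R \<nu>\<bar> \<le> \<epsilon> * \<bar>\<nu> - x\<bar> ^ (p + 2)"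
  shows "((\<lambda>l. l * Re ((deriv ^^ p) (kappa_moment.T_complex a x l R) (of_real x))) \<longlongrightarrow> 0) at_top"
proof (rule tendstoI)
  fix e :: real assume e: "e > 0"
  obtain B where B: "\<forall>\<^sub>F l in at_top. kappa_moment a x l N B"
    using eventually_kappa_moment[OF a N] by blast
  have K: "K \<ge> 0"
  proof -
    have "0 \<le> K * exp ((N - 1) * \<bar>x - x\<bar>)" using order_trans[OF abs_ge_zero growth] .
    thus ?thesis by simp
  qed
  define C where "C = fact p * exp (8 / a\<^sup>2) * B"
  define \<epsilon> where "\<epsilon> = e / (2 * (\<bar>C\<bar> * fact (p + 2) + 1))"
  have den: "\<bar>C\<bar> * fact (p + 2) + 1 > 0" by (intro add_nonneg_pos) auto
  have \<epsilon>: "\<epsilon> > 0" using e den by (simp add: \<epsilon>_def)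
  obtain \<delta> where \<delta>: "\<delta> > 0" "\<And>\<nu>. \<bar>\<nu> - x\<bar> < \<delta> \<Longrightarrow> \<bar>R \<nu>\<bar> \<le> \<epsilon> * \<bar>\<nu> - x\<bar> ^ (p + 2)"
    using small[OF \<epsilon>] by blast
  have "((\<lambda>l. C * (\<epsilon> * fact (p + 2) + K * (sqrt l ^ (p + 2) * exp (- (\<delta> * sqrt l))))) \<longlongrightarrow> C * (\<epsilon> * fact (p + 2) + K * 0)) at_top"
    by (intro tendsto_intros tendsto_sqrt_power_mult_exp \<delta>)
  moreover have "C * (\<epsilon> * fact (p + 2) + K * 0) < e"
  proof -
    have "C * (\<epsilon> * fact (p + 2)) \<le> \<bar>C\<bar> * (\<epsilon> * fact (p + 2))"
      using \<epsilon> by (intro mult_right_mono) auto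
    also have "\<dots> \<le> \<epsilon> * (\<bar>C\<bar> * fact (p + 2) + 1)" using \<epsilon> by (simp add: algebra_simps)
    also have "\<dots> = e / 2"
    proof -
      have "e / (2 * d) * d = e / 2" if "d > 0" for d using that by simp
      from this[OF den] show ?thesis unfolding \<epsilon>_def .
    qed
    finally show ?thesis using e by simp
  qed
  ultimately have "\<forall>\<^sub>F l in at_top. C * (\<epsilon> * fact (p + 2) + K * (sqrt l ^ (p + 2) * exp (- (\<delta> * sqrt l)))) < e"
    by (rule order_tendstoD)
  thus "\<forall>\<^sub>F l in at_top. dist (l * Re ((deriv ^^ p) (kappa_moment.T_complex a x l R) (of_real x))) 0 < e"
    using B eventually_gt_at_top[of 0]
  proof eventually_elim
    case (elim l)
    interpret kappa_moment a x l N B by fact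
    have "dist (l * Re ((deriv ^^ p) (T_complex R) (of_real x))) 0 \<le> l * norm ((deriv ^^ p) (T_complex R) (of_real x))"
      using elim(3) abs_Re_le_cmod by (auto simp: abs_mult intro!: mult_left_mono)
    also have "\<dots> \<le> C * (\<epsilon> * fact (p + 2) + K * (sqrt l ^ (p + 2) * exp (- (\<delta> * sqrt l))))"
      unfolding C_def using higher_deriv_T_complex_le[OF R growth K \<delta>(2)] \<epsilon> by simp
    also have "\<dots> < e" by fact
    finally show ?case .
  qed
qed

lemma coeff_monomial_image_Suc:
  "coeff (monomial_image a x c (Suc j)) 0 = c * ((a\<^sup>2 + x\<^sup>2) * coeff (monomial_image a x c j) 1)"
  "coeff (monomial_image a x c (Suc j)) (Suc k) = coeff (monomial_image a x c j) k
     + c * ((a\<^sup>2 + x\<^sup>2) * (real (k + 2) * coeff (monomial_image a x c j) (k + 2))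
          + 2 * x * (real (k + 1) * coeff (monomial_image a x c j) (k + 1))
          + real k * coeff (monomial_image a x c j) k)"
proof -
  let ?p = "monomial_image a x c j"
  have "[:a\<^sup>2 + x\<^sup>2, 2 * x, 1:] * pderiv ?p
      = smult (a\<^sup>2 + x\<^sup>2) (pderiv ?p) + pCons 0 (smult (2 * x) (pderiv ?p) + pCons 0 (pderiv ?p))"
    by simp
  thus "coeff (monomial_image a x c (Suc j)) 0 = c * ((a\<^sup>2 + x\<^sup>2) * coeff ?p 1)"
    and "coeff (monomial_image a x c (Suc j)) (Suc k) = coeff ?p k
     + c * ((a\<^sup>2 + x\<^sup>2) * (real (k + 2) * coeff ?p (k + 2))
          + 2 * x * (real (k + 1) * coeff ?p (k + 1)) + real k * coeff ?p k)"
    unfolding monomial_image_Suc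
    by (simp_all only: coeff_add coeff_smult coeff_pCons coeff_pderiv nat.case)
      (cases k; simp add: coeff_pderiv algebra_simps)+
qed

lemma tendsto_coeff_monomial_image:
  "((\<lambda>l. l * (coeff (monomial_image a x (1 / l) j) k - (if k = j then 1 else 0))) \<longlongrightarrow>
      real j * (real j - 1) / 2 * ((a\<^sup>2 + x\<^sup>2) * (if k + 2 = j then 1 else 0)
        + 2 * x * (if k + 1 = j then 1 else 0) + (if k = j then 1 else 0))) at_top"
proof (induction j arbitrary: k)
  case 0
  show ?case by (simp add: monomial_image_0 coeff_1)
next
  case (Suc j)
  let ?b = "\<lambda>k l. coeff (monomial_image a x (1 / l) j) k"
  let ?i = "\<lambda>b. if b then 1 else (0::real)"
  have lim: "(?b k \<longlongrightarrow> ?i (k = j)) at_top" for k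
  proof -
    from tendsto_add[OF tendsto_mult[OF Suc.IH[of k] tendsto_inverse_0_at_top[OF filterlim_ident]] tendsto_const[of "?i (k = j)"]]
    have "((\<lambda>l. l * (?b k l - ?i (k = j)) * inverse l + ?i (k = j)) \<longlongrightarrow> ?i (k = j)) at_top" by simp
    moreover have "\<forall>\<^sub>F l in at_top. l * (?b k l - ?i (k = j)) * inverse l + ?i (k = j) = ?b k l"
      using eventually_gt_at_top[of 0] by eventually_elim (simp add: field_simps)
    ultimately show ?thesis by (rule Lim_transform_eventually)
  qed
  show ?case
  proof (cases k)
    case 0
    have "((\<lambda>l. (a\<^sup>2 + x\<^sup>2) * ?b 1 l) \<longlongrightarrow> (a\<^sup>2 + x\<^sup>2) * ?i (1 = j)) at_top"
      by (intro tendsto_intros lim)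
    moreover have "\<forall>\<^sub>F l in at_top. (a\<^sup>2 + x\<^sup>2) * ?b 1 l = l * (coeff (monomial_image a x (1 / l) (Suc j)) k - ?i (k = Suc j))"
      using eventually_gt_at_top[of 0] by eventually_elim (simp add: 0 coeff_monomial_image_Suc)
    ultimately have "((\<lambda>l. l * (coeff (monomial_image a x (1 / l) (Suc j)) k - ?i (k = Suc j))) \<longlongrightarrow> (a\<^sup>2 + x\<^sup>2) * ?i (1 = j)) at_top"
      by (rule Lim_transform_eventually)
    thus ?thesis by (cases "j = 1"; cases "j = 0") (auto simp: 0)
  next
    case k: (Suc k')
    have "((\<lambda>l. l * (?b k' l - ?i (k' = j)) + ((a\<^sup>2 + x\<^sup>2) * (real (k' + 2) * ?b (k' + 2) l)
          + 2 * x * (real (k' + 1) * ?b (k' + 1) l) + real k' * ?b k' l)) \<longlongrightarrow>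
        real j * (real j - 1) / 2 * ((a\<^sup>2 + x\<^sup>2) * ?i (k' + 2 = j) + 2 * x * ?i (k' + 1 = j) + ?i (k' = j))
        + ((a\<^sup>2 + x\<^sup>2) * (real (k' + 2) * ?i (k' + 2 = j)) + 2 * x * (real (k' + 1) * ?i (k' + 1 = j)) + real k' * ?i (k' = j))) at_top"
      by (intro tendsto_intros Suc.IH lim)
    moreover have "\<forall>\<^sub>F l in at_top. l * (?b k' l - ?i (k' = j)) + ((a\<^sup>2 + x\<^sup>2) * (real (k' + 2) * ?b (k' + 2) l)
          + 2 * x * (real (k' + 1) * ?b (k' + 1) l) + real k' * ?b k' l)
        = l * (coeff (monomial_image a x (1 / l) (Suc j)) k - ?i (k = Suc j))"
      using eventually_gt_at_top[of 0]
    proof eventually_elim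
      case (elim l)
      have "l * (u - v) + w = l * (u + 1 / l * w - v)" for u v w using elim by (simp add: algebra_simps)
      thus ?case by (simp only: k coeff_monomial_image_Suc nat.inject)
    qed
    ultimately have "((\<lambda>l. l * (coeff (monomial_image a x (1 / l) (Suc j)) k - ?i (k = Suc j))) \<longlongrightarrow>
        real j * (real j - 1) / 2 * ((a\<^sup>2 + x\<^sup>2) * ?i (k' + 2 = j) + 2 * x * ?i (k' + 1 = j) + ?i (k' = j))
        + ((a\<^sup>2 + x\<^sup>2) * (real (k' + 2) * ?i (k' + 2 = j)) + 2 * x * (real (k' + 1) * ?i (k' + 1 = j)) + real k' * ?i (k' = j))) at_top"
      by (rule Lim_transform_eventually)
    also have "real j * (real j - 1) / 2 * ((a\<^sup>2 + x\<^sup>2) * ?i (k' + 2 = j) + 2 * x * ?i (k' + 1 = j) + ?i (k' = j))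
        + ((a\<^sup>2 + x\<^sup>2) * (real (k' + 2) * ?i (k' + 2 = j)) + 2 * x * (real (k' + 1) * ?i (k' + 1 = j)) + real k' * ?i (k' = j))
        = real (Suc j) * (real (Suc j) - 1) / 2 * ((a\<^sup>2 + x\<^sup>2) * ?i (k + 2 = Suc j) + 2 * x * ?i (k + 1 = Suc j) + ?i (k = Suc j))"
    proof -
      have "real (k' + 2) * ?i (k' + 2 = j) = real j * ?i (k' + 2 = j)"
        "real (k' + 1) * ?i (k' + 1 = j) = real j * ?i (k' + 1 = j)"
        "real k' * ?i (k' = j) = real j * ?i (k' = j)" by auto
      moreover have "r * (r - 1) / 2 * (s * u + 2 * x * v + w) + (s * (r * u) + 2 * x * (r * v) + r * w)
          = (r + 1) * r / 2 * (s * u + 2 * x * v + w)" for r s u v w :: real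
        by (simp add: field_simps)
      ultimately show ?thesis by (simp only: k add_Suc nat.inject of_nat_Suc add_diff_cancel_left' add_diff_cancel_right' add.commute[of 1])
    qed
    finally show ?thesis .
  qed
qed

lemma higher_deriv_poly_shift:
  fixes q :: "'a::real_normed_field poly"
  shows "(deriv ^^ k) (\<lambda>w. poly q (w - z)) = (\<lambda>w. poly ((pderiv ^^ k) q) (w - z))"
proof (induction k)
  case (Suc k)
  have "((\<lambda>w. poly ((pderiv ^^ k) q) (w - z)) has_field_derivative poly (pderiv ((pderiv ^^ k) q)) (w - z)) (at w)" for w
    by (auto intro!: derivative_eq_intros poly_DERIV)
  thus ?case by (auto simp: Suc DERIV_imp_deriv)
qed simp

lemma higher_deriv_poly_shift_center:
  fixes q :: "'a::real_normed_field poly"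
  shows "(deriv ^^ k) (\<lambda>w. poly q (w - z)) z = fact k * coeff q k"
  by (simp add: higher_deriv_poly_shift poly_0_coeff_0 coeff_higher_pderiv pochhammer_fact)

lemma poly_map_poly_of_real:
  "of_real (poly q t) = poly (map_poly complex_of_real q) (of_real t)"
  by (induction q) (simp_all add: map_poly_pCons)

lemma abs_le_of_exponential_growth:
  assumes "K \<ge> 0" "N \<ge> 0" and "\<bar>y\<bar> \<le> K * exp (N * \<bar>\<nu>\<bar>)"
  shows "\<bar>y :: real\<bar> \<le> K * exp (N * \<bar>x\<bar>) * exp ((N + 1) * \<bar>\<nu> - x\<bar>)"
proof -
  have "N * \<bar>\<nu>\<bar> \<le> N * (\<bar>x\<bar> + \<bar>\<nu> - x\<bar>)" using assms by (intro mult_left_mono) auto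
  also have "\<dots> \<le> N * \<bar>x\<bar> + (N + 1) * \<bar>\<nu> - x\<bar>" by (simp add: algebra_simps)
  finally have "exp (N * \<bar>\<nu>\<bar>) \<le> exp (N * \<bar>x\<bar>) * exp ((N + 1) * \<bar>\<nu> - x\<bar>)"
    by (simp only: exp_add[symmetric] exp_le_cancel_iff)
  hence "K * exp (N * \<bar>\<nu>\<bar>) \<le> K * (exp (N * \<bar>x\<bar>) * exp ((N + 1) * \<bar>\<nu> - x\<bar>))"
    using assms by (intro mult_left_mono)
  thus ?thesis using assms(3) by (simp only: mult.assoc)
qed

lemma abs_Taylor_polynomial_le:
  assumes "N \<ge> 0"
  shows "\<bar>\<Sum>j\<le>n. c j / fact j * (\<nu> - x) ^ j\<bar> \<le> (\<Sum>j\<le>n. \<bar>c j\<bar>) * exp ((N + 1) * \<bar>\<nu> - x :: real\<bar>)"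
proof -
  have "\<bar>c j / fact j * (\<nu> - x) ^ j\<bar> \<le> \<bar>c j\<bar> * exp ((N + 1) * \<bar>\<nu> - x\<bar>)" for j
  proof -
    have "\<bar>c j / fact j * (\<nu> - x) ^ j\<bar> = \<bar>c j\<bar> / fact j * \<bar>\<nu> - x\<bar> ^ j"
      by (simp add: abs_mult power_abs)
    also have "\<dots> \<le> \<bar>c j\<bar> / fact j * (fact j * exp \<bar>\<nu> - x\<bar>)"
      by (intro mult_left_mono power_le_fact_exp) auto
    also have "\<dots> = \<bar>c j\<bar> * exp \<bar>\<nu> - x\<bar>" by simp
    also have "\<dots> \<le> \<bar>c j\<bar> * exp ((N + 1) * \<bar>\<nu> - x\<bar>)"
      using assms by (intro mult_left_mono) (auto simp: distrib_right)
    finally show ?thesis .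
  qed
  hence "(\<Sum>j\<le>n. \<bar>c j / fact j * (\<nu> - x) ^ j\<bar>) \<le> (\<Sum>j\<le>n. \<bar>c j\<bar> * exp ((N + 1) * \<bar>\<nu> - x\<bar>))"
    by (intro sum_mono)
  thus ?thesis unfolding sum_distrib_right by (intro order_trans[OF sum_abs])
qed

theorem (in kappa_moment) T_op_Taylor_decomposition:
  fixes f R :: "real \<Rightarrow> real" and b :: "nat \<Rightarrow> real"
  assumes N2: "N \<ge> 2"
    and f: "f \<in> borel_measurable borel" "\<And>\<nu>. \<bar>f \<nu>\<bar> \<le> K * exp ((N - 1) * \<bar>\<nu> - x\<bar>)"
    and R: "R \<in> borel_measurable borel" "\<And>\<nu>. \<bar>R \<nu>\<bar> \<le> L * exp ((N - 1) * \<bar>\<nu> - x\<bar>)"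
    and eq: "\<And>\<nu>. f \<nu> = (\<Sum>j\<le>n. b j * (\<nu> - x) ^ j) + R \<nu>"
  shows "\<forall>\<^sub>F y in nhds x. T_integrable l a f y"
    and "nth_deriv_exists p (T_op l a f) x"
    and "(deriv ^^ p) (T_op l a f) x
           = (\<Sum>j\<le>n. fact p * b j * coeff (monomial_image a x (1 / l) j) p) + Re ((deriv ^^ p) (T_complex R) (of_real x))"
proof -
  let ?S = "ball (complex_of_real x) (2 / sqrt l)"
  have growth: "\<bar>h \<nu>\<bar> \<le> M * exp (N * dev \<nu>)" if "\<And>\<nu>. \<bar>h \<nu>\<bar> \<le> M * exp ((N - 1) * \<bar>\<nu> - x\<bar>)" for h :: "real \<Rightarrow> real" and M \<nu>
  proof -
    have "0 \<le> M * exp ((N - 1) * \<bar>\<nu> - x\<bar>)" using order_trans[OF abs_ge_zero that] .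
    hence "M \<ge> 0" by (simp add: zero_le_mult_iff)
    have "(N - 1) * \<bar>\<nu> - x\<bar> \<le> (N - 1) * dev \<nu>" using N abs_le_dev by (intro mult_left_mono) auto
    also have "\<dots> \<le> N * dev \<nu>" using dev_nonneg by (simp add: left_diff_distrib)
    finally have "M * exp ((N - 1) * \<bar>\<nu> - x\<bar>) \<le> M * exp (N * dev \<nu>)" using \<open>M \<ge> 0\<close> by (intro mult_left_mono) auto
    thus ?thesis using that[of \<nu>] by (rule order_trans[rotated])
  qed
  note fg = growth[OF f(2)] and Rg = growth[OF R(2)]
  have xS: "complex_of_real x \<in> ?S" using l by simp
  have near: "\<bar>y - x\<bar> < 2 / sqrt l" if "complex_of_real y \<in> ?S" for y
    using that by (simp add: dist_norm norm_minus_commute flip: of_real_diff)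
  have "open (complex_of_real -` ?S)" by (intro open_vimage open_ball continuous_intros)
  hence "\<forall>\<^sub>F y in nhds x. complex_of_real y \<in> ?S" using xS by (auto simp: eventually_nhds simp del: mem_ball)
  thus "\<forall>\<^sub>F y in nhds x. T_integrable l a f y"
    by (rule eventually_mono) (rule T_complex_of_real(1)[OF f(1) fg less_imp_le[OF near]])
  define q where "q = (\<Sum>j\<le>n. smult (b j) (monomial_image a x (1 / l) j))"
  define G where "G w = poly (map_poly complex_of_real q) (w - of_real x) + T_complex R w" for w
  have T_f: "T_op l a f y = poly q (y - x) + T_op l a R y" if y: "\<bar>y - x\<bar> < 2 / sqrt l" for y
  proof -
    have int: "integrable lborel (\<lambda>\<nu>. kappa l a y \<nu> * (\<nu> - x) ^ j)" for j
      using T_complex_of_real(1)[OF _ abs_power_le_exp_dev less_imp_le[OF y]] by (simp add: T_integrable_def)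
    have intR: "integrable lborel (\<lambda>\<nu>. kappa l a y \<nu> * R \<nu>)"
      using T_complex_of_real(1)[OF R(1) Rg less_imp_le[OF y]] by (simp add: T_integrable_def)
    have "kappa l a y \<nu> * f \<nu> = (\<Sum>j\<le>n. b j * (kappa l a y \<nu> * (\<nu> - x) ^ j)) + kappa l a y \<nu> * R \<nu>" for \<nu>
      unfolding eq by (simp add: distrib_left sum_distrib_left mult_ac)
    hence "T_op l a f y = (\<Sum>j\<le>n. b j * T_op l a (\<lambda>\<nu>. (\<nu> - x) ^ j) y) + T_op l a R y"
      unfolding T_op_def using int intR by simp
    thus ?thesis by (simp add: q_def poly_sum T_op_monomial[OF N2 y])
  qed
  have poly_hol: "(\<lambda>w. poly (map_poly complex_of_real q) (w - of_real x)) holomorphic_on ?S"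
    by (intro holomorphic_intros)
  have G_hol: "G holomorphic_on ?S"
    unfolding G_def by (intro holomorphic_on_add poly_hol T_complex_holomorphic[OF R(1) Rg])
  have G_real: "G (of_real y) = of_real (T_op l a f y)" if "complex_of_real y \<in> ?S" for y
  proof -
    have "poly (map_poly complex_of_real q) (of_real y - of_real x) = of_real (poly q (y - x))"
      by (simp flip: of_real_diff poly_map_poly_of_real)
    thus ?thesis using T_complex_of_real(2)[OF R(1) Rg less_imp_le[OF near[OF that]]] T_f[OF near[OF that]]
      by (simp add: G_def)
  qed
  note ext = nth_deriv_holomorphic_extension[OF open_ball G_hol G_real xS]
  from ext show "nth_deriv_exists p (T_op l a f) x" by blast
  have "complex_of_real ((deriv ^^ p) (T_op l a f) x) = (deriv ^^ p) G (of_real x)" using ext by simp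
  also have "\<dots> = (deriv ^^ p) (\<lambda>w. poly (map_poly complex_of_real q) (w - of_real x)) (of_real x) + (deriv ^^ p) (T_complex R) (of_real x)"
    unfolding G_def by (rule higher_deriv_add[OF poly_hol T_complex_holomorphic[OF R(1) Rg] open_ball xS])
  also have "(deriv ^^ p) (\<lambda>w. poly (map_poly complex_of_real q) (w - of_real x)) (of_real x) = of_real (fact p * coeff q p)"
    unfolding higher_deriv_poly_shift_center by (simp add: coeff_map_poly)
  finally have "(deriv ^^ p) (T_op l a f) x = fact p * coeff q p + Re ((deriv ^^ p) (T_complex R) (of_real x))"
    by (metis Re_complex_of_real plus_complex.simps(1))
  thus "(deriv ^^ p) (T_op l a f) x
           = (\<Sum>j\<le>n. fact p * b j * coeff (monomial_image a x (1 / l) j) p) + Re ((deriv ^^ p) (T_complex R) (of_real x))"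
    by (simp add: q_def coeff_sum sum_distrib_left mult.assoc)
qed

theorem theorem4:
  fixes a K N x :: real and p :: nat and f :: "real \<Rightarrow> real"
  assumes "a > 0"
    and "K \<ge> 0" and "N \<ge> 0"
    and "continuous_on UNIV f"
    and "\<And>\<nu>. \<bar>f \<nu>\<bar> \<le> K * exp (N * \<bar>\<nu>\<bar>)"
    and "nth_deriv_exists (p + 2) f x"
  shows "(\<forall>\<^sub>F l in at_top. (\<forall>\<^sub>F y in nhds x. T_integrable l a f y)
            \<and> nth_deriv_exists p (T_op l a f) x)
       \<and> ((\<lambda>l. l * ((deriv ^^ p) (T_op l a f) x - (deriv ^^ p) f x)) \<longlongrightarrow>
            real p * (real p - 1) / 2 * (deriv ^^ p) f x
            + real p * x * (deriv ^^ (p + 1)) f x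
            + (a\<^sup>2 + x\<^sup>2) / 2 * (deriv ^^ (p + 2)) f x) at_top"
proof -
  define b where "b j = (deriv ^^ j) f x / fact j" for j
  define R where "R \<nu> = f \<nu> - (\<Sum>j\<le>p + 2. b j * (\<nu> - x) ^ j)" for \<nu>
  define M where "M = K * exp (N * \<bar>x\<bar>)"
  define M' where "M' = (\<Sum>j\<le>p + 2. \<bar>(deriv ^^ j) f x\<bar>)"
  have f_meas: "f \<in> borel_measurable borel"
    using assms(4) by (rule borel_measurable_continuous_onI)
  have R_meas: "R \<in> borel_measurable borel"
    unfolding R_def using f_meas by measurable
  have shift: "N + 2 - 1 = N + 1" by simp
  have f_growth: "\<bar>f \<nu>\<bar> \<le> M * exp ((N + 2 - 1) * \<bar>\<nu> - x\<bar>)" for \<nu>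
    unfolding M_def shift by (rule abs_le_of_exponential_growth[OF assms(2,3,5)])
  have R_growth: "\<bar>R \<nu>\<bar> \<le> (M + M') * exp ((N + 2 - 1) * \<bar>\<nu> - x\<bar>)" for \<nu>
  proof -
    have "\<bar>R \<nu>\<bar> \<le> \<bar>f \<nu>\<bar> + \<bar>\<Sum>j\<le>p + 2. b j * (\<nu> - x) ^ j\<bar>" unfolding R_def by (rule abs_triangle_ineq4)
    also have "\<dots> \<le> M * exp ((N + 2 - 1) * \<bar>\<nu> - x\<bar>) + M' * exp ((N + 1) * \<bar>\<nu> - x\<bar>)"
      unfolding b_def M'_def by (intro add_mono f_growth abs_Taylor_polynomial_le assms(3))
    also have "\<dots> = (M + M') * exp ((N + 2 - 1) * \<bar>\<nu> - x\<bar>)" by (simp only: shift distrib_right)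
    finally show ?thesis .
  qed
  have small: "\<exists>\<delta>>0. \<forall>\<nu>. \<bar>\<nu> - x\<bar> < \<delta> \<longrightarrow> \<bar>R \<nu>\<bar> \<le> \<epsilon> * \<bar>\<nu> - x\<bar> ^ (p + 2)" if "\<epsilon> > 0" for \<epsilon>
    using Taylor_Peano[of "Suc p" f x, OF _ that] assms(6) unfolding R_def b_def by simp
  have eq: "f \<nu> = (\<Sum>j\<le>p + 2. b j * (\<nu> - x) ^ j) + R \<nu>" for \<nu> by (simp add: R_def)
  have N1: "N + 2 \<ge> 1" and N2: "N + 2 \<ge> 2" using assms(3) by auto
  obtain B where B: "\<forall>\<^sub>F l in at_top. kappa_moment a x l (N + 2) B"
    using eventually_kappa_moment[OF assms(1) N1] by blast
  note decomposition = kappa_moment.T_op_Taylor_decomposition[OF _ N2 f_meas f_growth R_meas R_growth eq]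
  let ?c = "\<lambda>l j. coeff (monomial_image a x (1 / l) j) p"
  let ?i = "\<lambda>j. if p = j then 1 else (0::real)"
  let ?\<beta> = "\<lambda>j. real j * (real j - 1) / 2 * ((a\<^sup>2 + x\<^sup>2) * (if p + 2 = j then 1 else 0)
        + 2 * x * (if p + 1 = j then 1 else 0) + (if p = j then 1 else 0))"
  have "((\<lambda>l. (\<Sum>j\<le>p + 2. fact p * b j * (l * (?c l j - ?i j))) + l * Re ((deriv ^^ p) (kappa_moment.T_complex a x l R) (of_real x)))
      \<longlongrightarrow> (\<Sum>j\<le>p + 2. fact p * b j * ?\<beta> j) + 0) at_top"
    by (intro tendsto_add tendsto_sum tendsto_mult tendsto_const tendsto_coeff_monomial_image
        tendsto_higher_deriv_T_complex[OF assms(1) N1 R_meas R_growth small])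
  moreover have "\<forall>\<^sub>F l in at_top. (\<Sum>j\<le>p + 2. fact p * b j * (l * (?c l j - ?i j))) + l * Re ((deriv ^^ p) (kappa_moment.T_complex a x l R) (of_real x))
      = l * ((deriv ^^ p) (T_op l a f) x - (deriv ^^ p) f x)"
    using B
  proof eventually_elim
    case (elim l)
    have "(\<Sum>j\<le>p + 2. fact p * b j * ?i j) = fact p * b p" by (simp add: if_distrib cong: if_cong)
    hence "(deriv ^^ p) f x = (\<Sum>j\<le>p + 2. fact p * b j * ?i j)" by (simp add: b_def)
    hence "l * ((deriv ^^ p) (T_op l a f) x - (deriv ^^ p) f x)
       = l * ((\<Sum>j\<le>p + 2. fact p * b j * ?c l j) - (\<Sum>j\<le>p + 2. fact p * b j * ?i j) + Re ((deriv ^^ p) (kappa_moment.T_complex a x l R) (of_real x)))"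
      unfolding decomposition(3)[OF elim] by (simp only: add_diff_eq diff_add_eq)
    also have "\<dots> = (\<Sum>j\<le>p + 2. fact p * b j * (l * (?c l j - ?i j))) + l * Re ((deriv ^^ p) (kappa_moment.T_complex a x l R) (of_real x))"
      unfolding distrib_left sum_subtractf[symmetric] sum_distrib_left by (simp only: right_diff_distrib mult_ac)
    finally show ?case by (rule sym)
  qed
  ultimately have "((\<lambda>l. l * ((deriv ^^ p) (T_op l a f) x - (deriv ^^ p) f x)) \<longlongrightarrow> (\<Sum>j\<le>p + 2. fact p * b j * ?\<beta> j) + 0) at_top"
    by (rule Lim_transform_eventually)
  also have "(\<Sum>j\<le>p + 2. fact p * b j * ?\<beta> j) + 0 = real p * (real p - 1) / 2 * (deriv ^^ p) f x
            + real p * x * (deriv ^^ (p + 1)) f x + (a\<^sup>2 + x\<^sup>2) / 2 * (deriv ^^ (p + 2)) f x"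
  proof -
    have "(\<Sum>j\<le>p + 2. fact p * b j * ?\<beta> j) = (\<Sum>j\<in>{p, p + 1, p + 2}. fact p * b j * ?\<beta> j)"
      by (rule sum.mono_neutral_right) auto
    also have "\<dots> = fact p * b p * (real p * (real p - 1) / 2)
        + fact p * b (p + 1) * (real (p + 1) * real p / 2 * (2 * x))
        + fact p * b (p + 2) * (real (p + 2) * real (p + 1) / 2 * (a\<^sup>2 + x\<^sup>2))" by simp
    also have "fact p * b p = (deriv ^^ p) f x" by (simp add: b_def)
    also have "fact p * b (p + 1) * (real (p + 1) * real p / 2 * (2 * x)) = real p * x * (fact (p + 1) * b (p + 1))"
      by (simp add: field_simps)
    also have "fact p * b (p + 2) * (real (p + 2) * real (p + 1) / 2 * (a\<^sup>2 + x\<^sup>2)) = (a\<^sup>2 + x\<^sup>2) / 2 * (fact (p + 2) * b (p + 2))"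
      by (simp add: field_simps)
    also have "fact (p + 1) * b (p + 1) = (deriv ^^ (p + 1)) f x" by (simp add: b_def)
    also have "fact (p + 2) * b (p + 2) = (deriv ^^ (p + 2)) f x" by (simp add: b_def)
    finally show ?thesis by (simp add: mult.commute)
  qed
  finally have "((\<lambda>l. l * ((deriv ^^ p) (T_op l a f) x - (deriv ^^ p) f x)) \<longlongrightarrow>
      real p * (real p - 1) / 2 * (deriv ^^ p) f x
      + real p * x * (deriv ^^ (p + 1)) f x + (a\<^sup>2 + x\<^sup>2) / 2 * (deriv ^^ (p + 2)) f x) at_top" .
  moreover have "\<forall>\<^sub>F l in at_top. (\<forall>\<^sub>F y in nhds x. T_integrable l a f y) \<and> nth_deriv_exists p (T_op l a f) x"
    using B by eventually_elim (use decomposition(1,2) in blast)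
  ultimately show ?thesis by blast
qed

end
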